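(* Let $\mathcal{L}$ be a finite bounded distributive lattice, let $\ell_1,\dots,\ell_k\in\mathcal{L}$ and let $n_1,\dots,n_k$ be non-zero natural numbers. The quasi-valuation $\nu_{\mathrm{Spec}}:\mathbb{C}(\mathbb{X}_{\mathcal{L}})\setminus\{0\}\to\mathbb{Z}^N$ satisfies the following properties: (1) For any maximal chain $\mathcal{C}$ of $\mathcal{L}$, $$\nu_{\mathrm{Spec}}(\hat x_{\ell_1}^{n_1}\cdots\hat x_{\ell_k}^{n_k})\le\nu_{\mathcal{C},\mathrm{Spec}}(\hat x_{\ell_1}^{n_1}\cdots\hat x_{\ell_k}^{n_k}),$$ and equality holds only if $\{\ell_1,\dots,\ell_k\}\subset\mathcal{C}$. (2) If the monomial $\hat x_{\ell_1}^{n_1}\cdots\hat x_{\ell_k}^{n_k}$ is standard, and $\mathcal{C}$ is a maximal chain containing $\{\ell_1,\dots,\ell_k\}$, then $$\nu_{\mathrm{Spec}}(\hat x_{\ell_1}^{n_1}\cdots\hat x_{\ell_k}^{n_k})=\sum_{j=1}^kn_j\nu_{\mathrm{Spec}}(\hat x_{\ell_j})=\sum_{j=1}^kn_j\nu_{\mathcal{C},\mathrm{Spec}}(\hat x_{\ell_j}).$$ (3) If the monomial $\hat x_{\ell_1}^{n_1}\cdots\hat x_{\ell_k}^{n_k}$ is not standard, then $$\nu_{\mathrm{Spec}}(\hat x_{\ell_1}^{n_1}\cdots\hat x_{\ell_k}^{n_k})>\sum_{j=1}^kn_j\nu_{\mathrm{Spec}}(\hat x_{\ell_j}).$$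
   Context: Lattice notation: $\mathbb{O}$ is the minimal element of $\mathcal{L}$; $m\in\mathcal{L}$ is join-irreducible if $m=\ell\vee\ell'$ implies $m=\ell$ or $m=\ell'$ (so $\mathbb{O}$ is join-irreducible); $J(\mathcal{L})$ is the set of join-irreducibles; $\mathrm{Spec}(\ell)=\{m\in J(\mathcal{L})\mid m\le\ell\}$ and $\mathrm{Spec}(\ell)^*=\mathrm{Spec}(\ell)\setminus\{\mathbb{O}\}$. $N=|J(\mathcal{L})|-1$ is the length of every maximal chain; $C(\mathcal{L})$ is the set of maximal chains. A maximal chain $\mathcal{C}=\{\mathbb{O}=c_0<\dots<c_N\}$ determines an enumeration $J(\mathcal{L})=\{m_0=\mathbb{O},m_1,\dots,m_N\}$, where $m_i$ ($i\ge1$) is the unique element of $\mathrm{Spec}(c_i)\setminus\mathrm{Spec}(c_{i-1})$. Hibi variety: $\mathbb{X}_{\mathcal{L}}\subset\mathbb{P}(\mathbb{C}^{|\mathcal{L}|})$ is the irreducible projective variety with homogeneous coordinate ring $R(\mathcal{L})=\mathbb{C}[X_\ell\mid\ell\in\mathcal{L}]/\langle X_{\ell}X_{\ell'}-X_{\ell\wedge\ell'}X_{\ell\vee\ell'}\mid\ell,\ell'\text{ non-comparable}\rangle$; $x_\ell$ is the class of $X_\ell$, and $\hat x_\ell=x_\ell/x_{\mathbb{O}}\in\mathbb{C}(\mathbb{X}_{\mathcal{L}})$ (so $\hat x_{\mathbb{O}}=1$). For each maximal chain, $\hat x_{c_1},\dots,\hat x_{c_N}$ are algebraically independent and $\mathbb{C}(\mathbb{X}_{\mathcal{L}})=\mathbb{C}(\hat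 x_{c_1},\dots,\hat x_{c_N})$. A monomial in the $\hat x_{\ell_j}$ (all exponents nonzero) is standard if its indices can be ordered so that $\ell_1\ge\dots\ge\ell_k$, i.e. they are pairwise comparable. Valuations: $\mathbb{Z}^N$ has standard basis $\mathbf{e}_1,\dots,\mathbf{e}_N$ and carries the reverse lexicographic total order: $\mathbf{a}>\mathbf{b}$ iff the last nonzero coordinate of $\mathbf{a}-\mathbf{b}$ is positive. For a maximal chain $\mathcal{C}$ set $\mathbf{v}_j=\sum_{m_i\in\mathrm{Spec}(c_j)^*}\mathbf{e}_i$. The valuation $\nu_{\mathcal{C},\mathrm{Spec}}$ on $\mathbb{C}(\mathbb{X}_{\mathcal{L}})$ is given on monomials by $\nu_{\mathcal{C},\mathrm{Spec}}(\hat x_{c_1}^{a_1}\cdots\hat x_{c_N}^{a_N})=\sum_ja_j\mathbf{v}_j$, on nonzero polynomials in $\hat x_{c_1},\dots,\hat x_{c_N}$ as the minimum over the monomials occurring, and on fractions by $\nu(f/g)=\nu(f)-\nu(g)$. Finally $\nu_{\mathrm{Spec}}(h)=\min\{\nu_{\mathcal{C},\mathrm{Spec}}(h)\mid\mathcal{C}\in C(\mathcal{L})\}$, a quasi-valuation (i.e. $\nu(f+g)\ge\min\{\nu(f),\nu(g)\}$, $\nu(cf)=\nu(f)$ for $c\in\mathbb{C}^*$, $\nu(fg)\ge\nu(f)+\nu(g)$).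
   Formalization: In (1), "equality holds only if {ℓ_1,…,ℓ_k} ⊂ C" is stated only for standard monomials; for every non-standard monomial it fails, since the minimum is attained at some chain but no chain contains the indices (e.g. x̂_a x̂_b = x̂_1 in the lattice {O,a,b,1}). *)

theory Defs
  imports
    Complex_Main
    "HOL-Library.Poly_Mapping"
    "HOL-Library.Countable"
    "HOL-Computational_Algebra.Fraction_Field"
    "HOL-Combinatorics.Permutations"
begin

section \<open>Finite distributive lattices\<close>

text \<open>
  A finite bounded distributive lattice is a type of sort
  \<open>{finite, distrib_lattice, bounded_lattice}\<close>; its minimal element is \<^term>\<open>bot\<close>.
  With the following definition \<^term>\<open>bot\<close> is join-irreducible.
\<close>

definition join_irreducible :: "'a::lattice \<Rightarrow> bool" where
  "join_irreducible m \<longleftrightarrow> (\<forall>l l'. m = sup l l' \<longrightarrow> m = l \<or> m = l')"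

definition Spec :: "'a::lattice \<Rightarrow> 'a set" where
  "Spec l = {m. join_irreducible m \<and> m \<le> l}"

definition Spec_star :: "'a::bounded_lattice \<Rightarrow> 'a set" where
  "Spec_star l = Spec l - {bot}"

definition lattice_rank :: "'a::lattice itself \<Rightarrow> nat" where
  "lattice_rank _ = card {m::'a. join_irreducible m} - 1"

definition max_chains :: "'a::order set set" where
  "max_chains = {C. pred_on.maxchain UNIV (<) C}"

text \<open>
  The element \<open>c\<^sub>i\<close> of a chain \<open>C = {c\<^sub>0 < \<dots> < c\<^sub>N}\<close> is the one with exactly \<open>i\<close> elements
  of \<open>C\<close> below it; the enumeration \<open>m\<^sub>i\<close> of the join-irreducibles is used for \<open>1 \<le> i \<le> N\<close>.
\<close>

definition chain_elem :: "'a::order set \<Rightarrow> nat \<Rightarrow> 'a" where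
  "chain_elem C i = (THE c. c \<in> C \<and> card {d \<in> C. d < c} = i)"

definition chain_irr :: "'a::lattice set \<Rightarrow> nat \<Rightarrow> 'a" where
  "chain_irr C i = (THE m. m \<in> Spec (chain_elem C i) - Spec (chain_elem C (i - 1)))"

lemma join_irreducible_bot: "join_irreducible (bot::'a::bounded_lattice)"
  by (auto simp: join_irreducible_def eq_commute[of bot])

lemma join_irreducible_prime:
  fixes m :: "'a::distrib_lattice"
  assumes "join_irreducible m"
  shows "m \<le> sup l l' \<longleftrightarrow> m \<le> l \<or> m \<le> l'"
proof
  assume "m \<le> sup l l'"
  then have "m = sup (inf m l) (inf m l')"
    by (metis inf.absorb1 inf_sup_distrib1)
  with assms have "m = inf m l \<or> m = inf m l'"
    unfolding join_irreducible_def by blast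
  then show "m \<le> l \<or> m \<le> l'" by (metis inf.cobounded2)
qed (auto intro: le_supI1 le_supI2)

lemma join_irreducible_le:
  fixes s t :: "'a::{finite,lattice}"
  assumes "\<And>m. join_irreducible m \<Longrightarrow> m \<le> s \<Longrightarrow> m \<le> t"
  shows "s \<le> t"
  using assms
proof (induction "card {x. x < s}" arbitrary: s rule: less_induct)
  case less
  show ?case
  proof (cases "join_irreducible s")
    case True
    then show ?thesis using less.prems by auto
  next
    case False
    then obtain l l' where s: "s = sup l l'" "s \<noteq> l" "s \<noteq> l'"
      by (auto simp: join_irreducible_def)
    have "x \<le> t" if "x < s" for x
    proof (rule less.hyps)
      show "card {y. y < x} < card {y. y < s}"
        using that by (intro psubset_card_mono) auto
    qed (use that less.prems in \<open>auto intro: order.trans\<close>)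
    moreover have "l < s" "l' < s" using s by (auto simp: less_le)
    ultimately show ?thesis using s by auto
  qed
qed


section \<open>Polynomials over the complex numbers\<close>

text \<open>
  The polynomial ring over \<open>\<complex>\<close> with variables indexed by \<^typ>\<open>'i\<close> is
  \<^typ>\<open>('i \<Rightarrow>\<^sub>0 nat) \<Rightarrow>\<^sub>0 complex\<close>; \<^term>\<open>Poly_Mapping.keys p\<close> is the set of
  (exponent vectors of) monomials occurring in \<open>p\<close>.
\<close>

definition var :: "'i \<Rightarrow> ('i \<Rightarrow>\<^sub>0 nat) \<Rightarrow>\<^sub>0 complex" where
  "var i = Poly_Mapping.single (Poly_Mapping.single i 1) 1"

definition homogeneous_poly :: "nat \<Rightarrow> (('i \<Rightarrow>\<^sub>0 nat) \<Rightarrow>\<^sub>0 complex) \<Rightarrow> bool" where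
  "homogeneous_poly d p \<longleftrightarrow>
     (\<forall>a \<in> Poly_Mapping.keys p. (\<Sum>i\<in>Poly_Mapping.keys a. Poly_Mapping.lookup a i) = d)"

definition poly_eval ::
  "(complex \<Rightarrow> 'r::comm_ring_1) \<Rightarrow> ('i \<Rightarrow> 'r) \<Rightarrow> (('i \<Rightarrow>\<^sub>0 nat) \<Rightarrow>\<^sub>0 complex) \<Rightarrow> 'r" where
  "poly_eval \<iota> x p = (\<Sum>a\<in>Poly_Mapping.keys p. \<iota> (Poly_Mapping.lookup p a) * (\<Prod>i\<in>Poly_Mapping.keys a. x i ^ Poly_Mapping.lookup a i))"

lemma sum_keys_plus:
  fixes G :: "'k \<Rightarrow> 'b::ab_group_add \<Rightarrow> 'c::ab_group_add"
  assumes "\<And>k x y. G k (x + y) = G k x + G k y"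
  shows "(\<Sum>k\<in>Poly_Mapping.keys (p + q). G k (Poly_Mapping.lookup (p + q) k)) =
    (\<Sum>k\<in>Poly_Mapping.keys p. G k (Poly_Mapping.lookup p k)) + (\<Sum>k\<in>Poly_Mapping.keys q. G k (Poly_Mapping.lookup q k))"
proof -
  have "G k 0 = 0" for k using assms[of k 0 0] by simp
  then show ?thesis by (intro setsum_keys_plus_distrib) (auto simp: assms)
qed

lemma poly_sum_single: "(\<Sum>k\<in>Poly_Mapping.keys p. Poly_Mapping.single k (Poly_Mapping.lookup p k)) = p"
  by (rule poly_mapping_eqI)
     (auto simp: lookup_sum lookup_single when_def in_keys_iff sum.If_cases
           intro: sum.neutral)

lemma degree_plus:
  fixes a b :: "'i \<Rightarrow>\<^sub>0 nat"
  shows "(\<Sum>i\<in>Poly_Mapping.keys (a + b). Poly_Mapping.lookup (a + b) i) =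
    (\<Sum>i\<in>Poly_Mapping.keys a. Poly_Mapping.lookup a i) + (\<Sum>i\<in>Poly_Mapping.keys b. Poly_Mapping.lookup b i)"
  by (rule setsum_keys_plus_distrib) auto

lemma homogeneous_poly_mult:
  assumes "homogeneous_poly d p" "homogeneous_poly e q"
  shows "homogeneous_poly (d + e) (p * q)"
  using assms keys_mult[of p q] unfolding homogeneous_poly_def
  by (fastforce simp: degree_plus)

lemma homogeneous_poly_add:
  assumes "homogeneous_poly d p" "homogeneous_poly d q"
  shows "homogeneous_poly d (p + q)"
  using assms keys_add[of p q] unfolding homogeneous_poly_def by blast

lemma homogeneous_poly_uminus:
  assumes "homogeneous_poly d p"
  shows "homogeneous_poly d (- p)"
  using assms unfolding homogeneous_poly_def by simp


section \<open>The Hibi ring\<close>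

definition hibi_relations ::
  "(('a::{finite,distrib_lattice,bounded_lattice} \<Rightarrow>\<^sub>0 nat) \<Rightarrow>\<^sub>0 complex) set" where
  "hibi_relations =
    {var l * var l' - var (inf l l') * var (sup l l') | l l'. \<not> l \<le> l' \<and> \<not> l' \<le> l}"

text \<open>The ideal generated by a set is its span in the ring regarded as a module over itself.\<close>

definition hibi_ideal ::
  "(('a::{finite,distrib_lattice,bounded_lattice} \<Rightarrow>\<^sub>0 nat) \<Rightarrow>\<^sub>0 complex) set" where
  "hibi_ideal = module.span (*) hibi_relations"

global_interpretation ring_module: module "(*) :: 'r::comm_ring_1 \<Rightarrow> 'r \<Rightarrow> 'r"
  by unfold_locales (simp_all add: algebra_simps)

subsection \<open>Primality of the ideal\<close>

text \<open>
  The ideal is the kernel of the map, into a polynomial ring with one variable for each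
  join-irreducible element, sending \<open>X\<^sub>l\<close> to the product of the variables in \<^term>\<open>Spec l\<close>.
\<close>

definition spec_mon :: "'a::{finite,distrib_lattice,bounded_lattice} \<Rightarrow> (nat \<Rightarrow>\<^sub>0 nat)" where
  "spec_mon l = (\<Sum>m\<in>Spec l. Poly_Mapping.single (to_nat m) 1)"

definition spec_weight ::
  "('a::{finite,distrib_lattice,bounded_lattice} \<Rightarrow>\<^sub>0 nat) \<Rightarrow> (nat \<Rightarrow>\<^sub>0 nat)" where
  "spec_weight a = (\<Sum>l\<in>UNIV. of_nat (Poly_Mapping.lookup a l) * spec_mon l)"

definition spec_hom ::
  "(('a::{finite,distrib_lattice,bounded_lattice} \<Rightarrow>\<^sub>0 nat) \<Rightarrow>\<^sub>0 complex) \<Rightarrow>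
   ((nat \<Rightarrow>\<^sub>0 nat) \<Rightarrow>\<^sub>0 complex)" where
  "spec_hom p = (\<Sum>a\<in>Poly_Mapping.keys p. Poly_Mapping.single (spec_weight a) (Poly_Mapping.lookup p a))"

lemma spec_weight_add: "spec_weight (a + b) = spec_weight a + spec_weight b"
  by (simp add: spec_weight_def lookup_add sum.distrib algebra_simps)

lemma spec_weight_0: "spec_weight 0 = 0"
  by (simp add: spec_weight_def)

lemma spec_weight_single: "spec_weight (Poly_Mapping.single l (Suc 0)) = spec_mon l"
proof -
  have "spec_weight (Poly_Mapping.single l (Suc 0)) = (\<Sum>k\<in>UNIV. if l = k then spec_mon k else 0)"
    unfolding spec_weight_def by (intro sum.cong) (auto simp: lookup_single)
  then show ?thesis by simp
qed

lemma spec_hom_add: "spec_hom (p + q) = spec_hom p + spec_hom q"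
  unfolding spec_hom_def by (rule sum_keys_plus) (rule single_add)

lemma spec_hom_0: "spec_hom 0 = 0"
  by (simp add: spec_hom_def)

lemma spec_hom_single: "spec_hom (Poly_Mapping.single a c) = Poly_Mapping.single (spec_weight a) c"
  by (simp add: spec_hom_def)

lemma spec_hom_sum: "spec_hom (sum f A) = (\<Sum>i\<in>A. spec_hom (f i))"
  by (induction A rule: infinite_finite_induct) (simp_all add: spec_hom_0 spec_hom_add)

lemma spec_hom_diff: "spec_hom (p - q) = spec_hom p - spec_hom q"
  using spec_hom_add[of "p - q" q] by simp

lemma spec_hom_mult: "spec_hom (p * q) = spec_hom p * spec_hom q"
proof -
  have "spec_hom ((\<Sum>a\<in>Poly_Mapping.keys p. Poly_Mapping.single a (Poly_Mapping.lookup p a)) *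
      (\<Sum>b\<in>Poly_Mapping.keys q. Poly_Mapping.single b (Poly_Mapping.lookup q b))) = spec_hom p * spec_hom q"
    unfolding sum_product spec_hom_sum
    by (simp only: mult_single spec_hom_single spec_weight_add) (simp only: spec_hom_def sum_product mult_single)
  then show ?thesis by (simp add: poly_sum_single)
qed

lemma lookup_spec_mon:
  fixes l m :: "'a::{finite,distrib_lattice,bounded_lattice}"
  shows "Poly_Mapping.lookup (spec_mon l) (to_nat m) = (if m \<in> Spec l then 1 else 0)"
proof -
  have "Poly_Mapping.lookup (spec_mon l) (to_nat m) = (\<Sum>k\<in>Spec l. if k = m then 1 else 0)"
    unfolding spec_mon_def lookup_sum by (intro sum.cong) (auto simp: lookup_single when_def)
  then show ?thesis by (simp add: sum.delta')
qed

lemma lookup_spec_mon_outside: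
  assumes "i \<notin> to_nat ` (UNIV :: 'a::{finite,distrib_lattice,bounded_lattice} set)"
  shows "Poly_Mapping.lookup (spec_mon (l :: 'a)) i = 0"
  using assms unfolding spec_mon_def lookup_sum
  by (intro sum.neutral) (auto simp: lookup_single when_def)

lemma spec_mon_modular:
  "spec_mon l + spec_mon l' = spec_mon (inf l l') + spec_mon (sup l l')"
proof (rule poly_mapping_eqI)
  fix i
  show "Poly_Mapping.lookup (spec_mon l + spec_mon l') i = Poly_Mapping.lookup (spec_mon (inf l l') + spec_mon (sup l l')) i"
  proof (cases "i \<in> to_nat ` (UNIV :: 'a set)")
    case True
    then obtain m :: 'a where "i = to_nat m" by auto
    then show ?thesis
      by (auto simp: lookup_add lookup_spec_mon Spec_def join_irreducible_prime)
  qed (simp add: lookup_add lookup_spec_mon_outside)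
qed

lemma spec_hom_hibi_ideal:
  assumes "p \<in> hibi_ideal"
  shows "spec_hom p = 0"
  using assms unfolding hibi_ideal_def
proof (induction rule: ring_module.span_induct_alt)
  case base
  show ?case by (rule spec_hom_0)
next
  case (step c x y)
  then have "spec_hom x = 0"
    by (auto simp: hibi_relations_def var_def spec_hom_diff mult_single spec_hom_single
        spec_weight_add spec_weight_single intro!: arg_cong2[of _ _ _ _ Poly_Mapping.single] spec_mon_modular)
  with step show ?case by (simp add: spec_hom_add spec_hom_mult)
qed

definition mon_equiv ::
  "('a::{finite,distrib_lattice,bounded_lattice} \<Rightarrow>\<^sub>0 nat) \<Rightarrow> ('a \<Rightarrow>\<^sub>0 nat) \<Rightarrow> bool" where
  "mon_equiv a b \<longleftrightarrow> Poly_Mapping.single a 1 - Poly_Mapping.single b (1::complex) \<in> hibi_ideal"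

lemma hibi_ideal_0: "0 \<in> hibi_ideal"
  unfolding hibi_ideal_def by (rule ring_module.span_zero)

lemma hibi_ideal_add: "p \<in> hibi_ideal \<Longrightarrow> q \<in> hibi_ideal \<Longrightarrow> p + q \<in> hibi_ideal"
  unfolding hibi_ideal_def by (rule ring_module.span_add)

lemma hibi_ideal_mult: "p \<in> hibi_ideal \<Longrightarrow> c * p \<in> hibi_ideal"
  unfolding hibi_ideal_def by (rule ring_module.span_scale)

lemma hibi_ideal_uminus: "p \<in> hibi_ideal \<Longrightarrow> - p \<in> hibi_ideal"
  unfolding hibi_ideal_def by (rule ring_module.span_neg)

lemma hibi_ideal_minus_commute: "p - q \<in> hibi_ideal \<Longrightarrow> q - p \<in> hibi_ideal"
  using hibi_ideal_uminus[of "p - q"] by simp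

lemma hibi_ideal_trans: "p - q \<in> hibi_ideal \<Longrightarrow> q - r \<in> hibi_ideal \<Longrightarrow> p - r \<in> hibi_ideal"
  using hibi_ideal_add[of "p - q" "q - r"] by simp

lemma mon_equiv_refl: "mon_equiv a a"
  by (simp add: mon_equiv_def hibi_ideal_0)

lemma mon_equiv_sym: "mon_equiv a b \<Longrightarrow> mon_equiv b a"
  unfolding mon_equiv_def by (rule hibi_ideal_minus_commute)

lemma mon_equiv_trans: "mon_equiv a b \<Longrightarrow> mon_equiv b c \<Longrightarrow> mon_equiv a c"
  unfolding mon_equiv_def by (rule hibi_ideal_trans)

lemma mon_equiv_add:
  assumes "mon_equiv a b" shows "mon_equiv (c + a) (c + b)"
  using hibi_ideal_mult[OF assms[unfolded mon_equiv_def], of "Poly_Mapping.single c 1"]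
  by (simp add: mon_equiv_def algebra_simps mult_single)

lemma mon_equiv_weight:
  assumes "mon_equiv a b" shows "spec_weight a = spec_weight b"
proof -
  have "Poly_Mapping.single (spec_weight a) 1 = Poly_Mapping.single (spec_weight b) (1::complex)"
    using spec_hom_hibi_ideal[OF assms[unfolded mon_equiv_def]]
    by (simp add: spec_hom_diff spec_hom_single)
  then have "Poly_Mapping.keys (Poly_Mapping.single (spec_weight a) (1::complex)) =
      Poly_Mapping.keys (Poly_Mapping.single (spec_weight b) (1::complex))" by simp
  then show ?thesis by simp
qed

lemma mon_equiv_hibi:
  "mon_equiv (Poly_Mapping.single l 1 + Poly_Mapping.single l' 1)
     (Poly_Mapping.single (inf l l') 1 + Poly_Mapping.single (sup l l') 1)"
proof (cases "l \<le> l' \<or> l' \<le> l")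
  case True
  then show ?thesis
    by (auto simp: inf_absorb1 inf_absorb2 sup_absorb1 sup_absorb2 add.commute mon_equiv_refl)
next
  case False
  then have "var l * var l' - var (inf l l') * var (sup l l') \<in> hibi_ideal"
    unfolding hibi_ideal_def by (intro ring_module.span_base) (auto simp: hibi_relations_def)
  then show ?thesis by (simp add: mon_equiv_def var_def mult_single)
qed

definition mon_list :: "'i list \<Rightarrow> ('i \<Rightarrow>\<^sub>0 nat)" where
  "mon_list xs = (\<Sum>x\<leftarrow>xs. Poly_Mapping.single x 1)"

lemma ex_mon_list: "\<exists>xs. a = mon_list xs" for a :: "'i \<Rightarrow>\<^sub>0 nat"
proof (induction "\<Sum>i\<in>Poly_Mapping.keys a. Poly_Mapping.lookup a i" arbitrary: a)
  case 0
  then have "a = 0" by (simp flip: keys_eq_empty) (metis equals0I in_keys_iff)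
  then show ?case by (intro exI[of _ "[]"]) (simp add: mon_list_def)
next
  case (Suc n)
  then obtain i where i: "i \<in> Poly_Mapping.keys a" by fastforce
  define b where "b = a - Poly_Mapping.single i 1"
  have a: "a = Poly_Mapping.single i 1 + b"
    using i by (intro poly_mapping_eqI) (auto simp: b_def lookup_add lookup_minus lookup_single when_def in_keys_iff)
  have "n = (\<Sum>i\<in>Poly_Mapping.keys b. Poly_Mapping.lookup b i)"
    using Suc(2) degree_plus[of "Poly_Mapping.single i 1" b] by (simp add: a[symmetric, unfolded One_nat_def])
  from Suc(1)[OF this] obtain xs where "b = mon_list xs" by auto
  with a show ?case by (intro exI[of _ "i # xs"]) (simp add: mon_list_def)
qed

lemma lookup_spec_weight_mon_list:
  assumes "join_irreducible m"
  shows "Poly_Mapping.lookup (spec_weight (mon_list xs)) (to_nat m) = length (filter (\<lambda>x. m \<le> x) xs)"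
  using assms
  by (induction xs) (simp_all add: mon_list_def spec_weight_0 spec_weight_add spec_weight_single
      lookup_add lookup_spec_mon Spec_def del: single_one)

lemma straighten:
  fixes xs :: "'a::{finite,distrib_lattice,bounded_lattice} list"
  assumes "xs \<noteq> []"
  shows "\<exists>ys t. mon_equiv (mon_list xs) (mon_list ys + Poly_Mapping.single t 1) \<and>
    (\<forall>m. join_irreducible m \<longrightarrow> (m \<le> t \<longleftrightarrow> (\<exists>x\<in>set xs. m \<le> x)))"
  using assms
proof (induction xs rule: list_nonempty_induct)
  case (single x)
  show ?case by (intro exI[of _ "[]"] exI[of _ x]) (simp add: mon_list_def mon_equiv_refl)
next
  case (cons x xs)
  then obtain ys t where t: "mon_equiv (mon_list xs) (mon_list ys + Poly_Mapping.single t 1)"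
    "\<forall>m. join_irreducible m \<longrightarrow> (m \<le> t \<longleftrightarrow> (\<exists>x\<in>set xs. m \<le> x))" by auto
  have "mon_equiv (mon_list (x # xs)) (mon_list ys + (Poly_Mapping.single x 1 + Poly_Mapping.single t 1))"
    using mon_equiv_add[OF t(1), of "Poly_Mapping.single x 1"]
    by (simp add: mon_list_def algebra_simps)
  from mon_equiv_trans[OF this mon_equiv_add[OF mon_equiv_hibi]]
  have "mon_equiv (mon_list (x # xs)) (mon_list (inf x t # ys) + Poly_Mapping.single (sup x t) 1)"
    by (simp add: mon_list_def algebra_simps)
  with t(2) show ?case
    by (intro exI[of _ "inf x t # ys"] exI[of _ "sup x t"]) (simp add: join_irreducible_prime)
qed

lemma weight_mon_equiv_list:
  "spec_weight (mon_list xs) = spec_weight (mon_list ys) \<Longrightarrow> mon_equiv (mon_list xs) (mon_list ys)"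
proof (induction "length xs" arbitrary: xs ys)
  case 0
  have "length (filter (\<lambda>x. bot \<le> x) xs) = length (filter (\<lambda>x. bot \<le> x) ys)"
    using 0 lookup_spec_weight_mon_list[OF join_irreducible_bot] by metis
  with 0 show ?case by (simp add: mon_equiv_refl)
next
  case (Suc n)
  have count: "length (filter (\<lambda>x. m \<le> x) xs) = length (filter (\<lambda>x. m \<le> x) ys)"
    if "join_irreducible m" for m
    using Suc(3) lookup_spec_weight_mon_list[OF that] by metis
  have ex: "(\<exists>x\<in>set xs. m \<le> x) \<longleftrightarrow> (\<exists>x\<in>set ys. m \<le> x)" if "join_irreducible m" for m
    using count[OF that] by (metis filter_False filter_empty_conv length_0_conv)
  have len: "length xs = length ys" using count[OF join_irreducible_bot] by simp
  have ne: "xs \<noteq> []" "ys \<noteq> []" using Suc(2) len by auto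
  obtain xs' s where s: "mon_equiv (mon_list xs) (mon_list xs' + Poly_Mapping.single s 1)"
    "\<forall>m. join_irreducible m \<longrightarrow> (m \<le> s \<longleftrightarrow> (\<exists>x\<in>set xs. m \<le> x))"
    using straighten[OF ne(1)] by auto
  obtain ys' t where t: "mon_equiv (mon_list ys) (mon_list ys' + Poly_Mapping.single t 1)"
    "\<forall>m. join_irreducible m \<longrightarrow> (m \<le> t \<longleftrightarrow> (\<exists>x\<in>set ys. m \<le> x))"
    using straighten[OF ne(2)] by auto
  have st: "s = t"
  proof (rule antisym)
    show "s \<le> t" using s(2) t(2) ex by (intro join_irreducible_le[of s t]) blast
    show "t \<le> s" using s(2) t(2) ex by (intro join_irreducible_le[of t s]) blast
  qed
  have w: "spec_weight (mon_list xs' + Poly_Mapping.single s 1) = spec_weight (mon_list xs)"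
    by (rule mon_equiv_weight[OF mon_equiv_sym[OF s(1)]])
  have w': "spec_weight (mon_list ys' + Poly_Mapping.single t 1) = spec_weight (mon_list ys)"
    by (rule mon_equiv_weight[OF mon_equiv_sym[OF t(1)]])
  have "mon_list (s # xs') = mon_list xs' + Poly_Mapping.single s 1"
    by (simp add: mon_list_def add.commute)
  then have "length (s # xs') = length xs"
    using w lookup_spec_weight_mon_list[OF join_irreducible_bot, of "s # xs'"]
      lookup_spec_weight_mon_list[OF join_irreducible_bot, of xs] by simp
  moreover have "spec_weight (mon_list xs') = spec_weight (mon_list ys')"
    using w w' Suc(3) st by (metis spec_weight_add add_right_cancel)
  ultimately have "mon_equiv (mon_list xs') (mon_list ys')"
    using Suc(2) by (intro Suc(1)) auto
  then have "mon_equiv (mon_list xs' + Poly_Mapping.single s 1) (mon_list ys' + Poly_Mapping.single t 1)"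
    using mon_equiv_add[of _ _ "Poly_Mapping.single s 1"] st by (metis add.commute)
  then show ?case using s(1) t(1) mon_equiv_trans mon_equiv_sym by blast
qed

lemma weight_mon_equiv: "spec_weight a = spec_weight b \<Longrightarrow> mon_equiv a b"
  using weight_mon_equiv_list ex_mon_list by metis

lemma hibi_ideal_iff: "p \<in> hibi_ideal \<longleftrightarrow> spec_hom p = 0"
proof
  assume 0: "spec_hom p = 0"
  define r where "r u = (SOME b::'a \<Rightarrow>\<^sub>0 nat. spec_weight b = u)" for u
  define \<psi> :: "((nat \<Rightarrow>\<^sub>0 nat) \<Rightarrow>\<^sub>0 complex) \<Rightarrow> (('a \<Rightarrow>\<^sub>0 nat) \<Rightarrow>\<^sub>0 complex)" where
    "\<psi> g = (\<Sum>u\<in>Poly_Mapping.keys g. Poly_Mapping.single (r u) (Poly_Mapping.lookup g u))" for g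
  have add: "\<psi> (g + h) = \<psi> g + \<psi> h" for g h
    unfolding \<psi>_def by (rule sum_keys_plus) (rule single_add)
  have z: "\<psi> 0 = 0" by (simp add: \<psi>_def)
  have sum: "\<psi> (sum f A) = (\<Sum>i\<in>A. \<psi> (f i))" for A :: "('a \<Rightarrow>\<^sub>0 nat) set" and f
    by (induction A rule: infinite_finite_induct) (simp_all add: z add)
  have sing: "\<psi> (Poly_Mapping.single u c) = Poly_Mapping.single (r u) c" for u c
    by (simp add: \<psi>_def)
  have "\<psi> (spec_hom p) = (\<Sum>a\<in>Poly_Mapping.keys p. Poly_Mapping.single (r (spec_weight a)) (Poly_Mapping.lookup p a))"
    unfolding spec_hom_def sum sing ..
  then have "p = (\<Sum>a\<in>Poly_Mapping.keys p. Poly_Mapping.single a (Poly_Mapping.lookup p a) -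
      Poly_Mapping.single (r (spec_weight a)) (Poly_Mapping.lookup p a))"
    by (simp add: 0 z sum_subtractf poly_sum_single)
  also have "\<dots> \<in> hibi_ideal"
    unfolding hibi_ideal_def
  proof (rule ring_module.span_sum, fold hibi_ideal_def)
    fix a :: "'a \<Rightarrow>\<^sub>0 nat"
    have "spec_weight (r (spec_weight a)) = spec_weight a"
      using someI[of "\<lambda>b::'a \<Rightarrow>\<^sub>0 nat. spec_weight b = spec_weight a" a] by (simp add: r_def)
    then have "mon_equiv a (r (spec_weight a))" by (intro weight_mon_equiv) simp
    from hibi_ideal_mult[OF this[unfolded mon_equiv_def], of "Poly_Mapping.single 0 (Poly_Mapping.lookup p a)"]
    show "Poly_Mapping.single a (Poly_Mapping.lookup p a) -
        Poly_Mapping.single (r (spec_weight a)) (Poly_Mapping.lookup p a) \<in> hibi_ideal"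
      by (simp add: right_diff_distrib mult_single)
  qed
  finally show "p \<in> hibi_ideal" .
qed (rule spec_hom_hibi_ideal)

lemma hibi_ideal_prime: "p * q \<in> hibi_ideal \<longleftrightarrow> p \<in> hibi_ideal \<or> q \<in> hibi_ideal"
  by (simp add: hibi_ideal_iff spec_hom_mult)

lemma single_notin_hibi_ideal: "Poly_Mapping.single a 1 \<notin> hibi_ideal"
  by (simp add: hibi_ideal_iff spec_hom_single flip: keys_eq_empty)

subsection \<open>The quotient ring\<close>

quotient_type (overloaded) 'a hibi_ring =
  "('a::{finite,distrib_lattice,bounded_lattice} \<Rightarrow>\<^sub>0 nat) \<Rightarrow>\<^sub>0 complex" /
  "\<lambda>p q. p - q \<in> hibi_ideal"
  morphisms rep_hibi hibi_class
  by (intro equivpI reflpI sympI transpI)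
     (simp add: hibi_ideal_0, erule hibi_ideal_minus_commute, erule (1) hibi_ideal_trans)

lemma hibi_class_surj: "\<exists>p. f = hibi_class p"
  by (induct f rule: hibi_ring.abs_induct) blast

instantiation hibi_ring :: ("{finite,distrib_lattice,bounded_lattice}") idom
begin

lift_definition zero_hibi_ring :: "'a hibi_ring" is 0 .
lift_definition one_hibi_ring :: "'a hibi_ring" is 1 .
lift_definition plus_hibi_ring :: "'a hibi_ring \<Rightarrow> 'a hibi_ring \<Rightarrow> 'a hibi_ring" is "(+)"
  by (simp add: hibi_ideal_iff spec_hom_diff spec_hom_add)
lift_definition minus_hibi_ring :: "'a hibi_ring \<Rightarrow> 'a hibi_ring \<Rightarrow> 'a hibi_ring" is "(-)"
  by (simp add: hibi_ideal_iff spec_hom_diff)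
lift_definition uminus_hibi_ring :: "'a hibi_ring \<Rightarrow> 'a hibi_ring" is uminus
  by (drule hibi_ideal_minus_commute) (simp only: minus_diff_minus minus_diff_eq)
lift_definition times_hibi_ring :: "'a hibi_ring \<Rightarrow> 'a hibi_ring \<Rightarrow> 'a hibi_ring" is "(*)"
  by (simp add: hibi_ideal_iff spec_hom_diff spec_hom_mult)

lemmas hibi_class_simps =
  zero_hibi_ring_def one_hibi_ring_def plus_hibi_ring.abs_eq minus_hibi_ring.abs_eq
  uminus_hibi_ring.abs_eq times_hibi_ring.abs_eq

instance
proof
  fix a b c :: "'a hibi_ring"
  obtain p where p: "a = hibi_class p" using hibi_class_surj by blast
  obtain q where q: "b = hibi_class q" using hibi_class_surj by blast
  obtain r where r: "c = hibi_class r" using hibi_class_surj by blast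
  show "a * b * c = a * (b * c)" unfolding p q r hibi_class_simps by (simp only: mult.assoc)
  show "a * b = b * a" unfolding p q hibi_class_simps by (simp only: mult.commute)
  show "1 * a = a" unfolding p hibi_class_simps by (simp only: mult_1_left)
  show "a + b + c = a + (b + c)" unfolding p q r hibi_class_simps by (simp only: add.assoc)
  show "a + b = b + a" unfolding p q hibi_class_simps by (simp only: add.commute)
  show "0 + a = a" unfolding p hibi_class_simps by (simp only: add_0_left)
  show "- a + a = 0" unfolding p hibi_class_simps by (simp only: left_minus)
  show "a - b = a + - b" unfolding p q hibi_class_simps by (simp only: diff_conv_add_uminus)
  show "(a + b) * c = a * c + b * c" unfolding p q r hibi_class_simps by (simp only: distrib_right)
  show "a * (b + c) = a * b + a * c" unfolding p q r hibi_class_simps by (simp only: distrib_left)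
  show "0 * a = 0" unfolding p hibi_class_simps by (simp only: mult_zero_left)
  show "a * 0 = 0" unfolding p hibi_class_simps by (simp only: mult_zero_right)
  show "(0::'a hibi_ring) \<noteq> 1"
    using single_notin_hibi_ideal[of 0] hibi_ideal_minus_commute[of 0 1]
    by (auto simp: hibi_class_simps hibi_ring.abs_eq_iff)
  show "a * b \<noteq> 0" if "a \<noteq> 0" "b \<noteq> 0"
    using that unfolding p q hibi_class_simps by (simp add: hibi_ring.abs_eq_iff hibi_ideal_prime)
qed

end

definition hibi_gen :: "'a::{finite,distrib_lattice,bounded_lattice} \<Rightarrow> 'a hibi_ring" where
  "hibi_gen l = hibi_class (var l)"

definition hibi_homogeneous ::
  "nat \<Rightarrow> 'a::{finite,distrib_lattice,bounded_lattice} hibi_ring \<Rightarrow> bool" where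
  "hibi_homogeneous d f \<longleftrightarrow> (\<exists>p. homogeneous_poly d p \<and> f = hibi_class p)"

lemma hibi_class_add: "hibi_class (p + q) = hibi_class p + hibi_class q"
  by (simp add: plus_hibi_ring.abs_eq)

lemma hibi_class_mult: "hibi_class (p * q) = hibi_class p * hibi_class q"
  by (simp add: times_hibi_ring.abs_eq)

lemma hibi_class_uminus: "hibi_class (- p) = - hibi_class p"
  by (simp add: uminus_hibi_ring.abs_eq)

lemma hibi_class_eq_0_iff: "hibi_class p = 0 \<longleftrightarrow> p \<in> hibi_ideal"
  by (simp add: zero_hibi_ring_def hibi_ring.abs_eq_iff)

lemma hibi_homogeneous_mult:
  "hibi_homogeneous d f \<Longrightarrow> hibi_homogeneous e g \<Longrightarrow> hibi_homogeneous (d + e) (f * g)"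
  unfolding hibi_homogeneous_def by (metis homogeneous_poly_mult hibi_class_mult)

lemma hibi_homogeneous_add:
  "hibi_homogeneous d f \<Longrightarrow> hibi_homogeneous d g \<Longrightarrow> hibi_homogeneous d (f + g)"
  unfolding hibi_homogeneous_def by (metis homogeneous_poly_add hibi_class_add)

lemma hibi_homogeneous_uminus: "hibi_homogeneous d f \<Longrightarrow> hibi_homogeneous d (- f)"
  unfolding hibi_homogeneous_def by (metis homogeneous_poly_uminus hibi_class_uminus)

lemma hibi_homogeneous_0: "hibi_homogeneous d 0"
  unfolding hibi_homogeneous_def homogeneous_poly_def
  by (intro exI[of _ 0]) (simp add: zero_hibi_ring_def)

lemma hibi_homogeneous_const: "hibi_homogeneous 0 (hibi_class (Poly_Mapping.single 0 c))"
  unfolding hibi_homogeneous_def homogeneous_poly_def by (intro exI conjI) auto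

lemma hibi_homogeneous_1: "hibi_homogeneous 0 1"
  using hibi_homogeneous_const[of 1] by (simp add: one_hibi_ring_def)

lemma hibi_homogeneous_gen: "hibi_homogeneous 1 (hibi_gen l)"
  unfolding hibi_homogeneous_def homogeneous_poly_def hibi_gen_def var_def
  by (intro exI conjI) auto

lemma hibi_gen_nonzero: "hibi_gen l \<noteq> 0"
  by (simp add: hibi_gen_def hibi_class_eq_0_iff var_def single_notin_hibi_ideal)


section \<open>The function field of the Hibi variety\<close>

text \<open>
  The function field of a projective variety is the degree 0 part of the
  homogeneous localization of its homogeneous coordinate ring.
\<close>

typedef (overloaded) 'a hibi_field =
  "{h :: 'a::{finite,distrib_lattice,bounded_lattice} hibi_ring fract.
     \<exists>f g d. hibi_homogeneous d f \<and> hibi_homogeneous d g \<and> g \<noteq> 0 \<and> h = Fract f g}"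
  morphisms hibi_fract Abs_hibi_field
  using hibi_homogeneous_1 by (intro exI[of _ "Fract 1 1"]) force

setup_lifting type_definition_hibi_field

instantiation hibi_field :: ("{finite,distrib_lattice,bounded_lattice}") field
begin

lift_definition zero_hibi_field :: "'a hibi_field" is 0
  unfolding Zero_fract_def using hibi_homogeneous_0 hibi_homogeneous_1 by force
lift_definition one_hibi_field :: "'a hibi_field" is 1
  unfolding One_fract_def using hibi_homogeneous_1 by force
lift_definition plus_hibi_field :: "'a hibi_field \<Rightarrow> 'a hibi_field \<Rightarrow> 'a hibi_field" is "(+)"
proof -
  fix h h' :: "'a hibi_ring fract"
  assume "\<exists>f g d. hibi_homogeneous d f \<and> hibi_homogeneous d g \<and> g \<noteq> 0 \<and> h = Fract f g"
    "\<exists>f g d. hibi_homogeneous d f \<and> hibi_homogeneous d g \<and> g \<noteq> 0 \<and> h' = Fract f g"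
  then obtain f g d f' g' d' where *: "hibi_homogeneous d f" "hibi_homogeneous d g" "g \<noteq> 0"
    "h = Fract f g" "hibi_homogeneous d' f'" "hibi_homogeneous d' g'" "g' \<noteq> 0" "h' = Fract f' g'"
    by metis
  show "\<exists>f g d. hibi_homogeneous d f \<and> hibi_homogeneous d g \<and> g \<noteq> 0 \<and> h + h' = Fract f g"
  proof (intro exI conjI)
    show "h + h' = Fract (f * g' + f' * g) (g * g')" using * by simp
    show "hibi_homogeneous (d + d') (f * g' + f' * g)"
      using * by (intro hibi_homogeneous_add) (metis hibi_homogeneous_mult add.commute)+
  qed (use * in \<open>auto intro: hibi_homogeneous_mult\<close>)
qed
lift_definition uminus_hibi_field :: "'a hibi_field \<Rightarrow> 'a hibi_field" is uminus
  by (metis hibi_homogeneous_uminus minus_fract)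
definition minus_hibi_field :: "'a hibi_field \<Rightarrow> 'a hibi_field \<Rightarrow> 'a hibi_field" where
  "minus_hibi_field h h' = h + (- h')"
lift_definition times_hibi_field :: "'a hibi_field \<Rightarrow> 'a hibi_field \<Rightarrow> 'a hibi_field" is "(*)"
  by (metis hibi_homogeneous_mult mult_fract no_zero_divisors)
lift_definition inverse_hibi_field :: "'a hibi_field \<Rightarrow> 'a hibi_field" is inverse
proof -
  fix h :: "'a hibi_ring fract"
  assume "\<exists>f g d. hibi_homogeneous d f \<and> hibi_homogeneous d g \<and> g \<noteq> 0 \<and> h = Fract f g"
  then obtain f g d where *: "hibi_homogeneous d f" "hibi_homogeneous d g" "g \<noteq> 0" "h = Fract f g"
    by metis
  show "\<exists>f g d. hibi_homogeneous d f \<and> hibi_homogeneous d g \<and> g \<noteq> 0 \<and> inverse h = Fract f g"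
  proof (cases "f = 0")
    case True
    then have "inverse h = Fract 0 1" using * by (simp add: fract_collapse)
    then show ?thesis using hibi_homogeneous_0 hibi_homogeneous_1 by force
  next
    case False
    then show ?thesis using * by (metis inverse_fract)
  qed
qed
definition divide_hibi_field :: "'a hibi_field \<Rightarrow> 'a hibi_field \<Rightarrow> 'a hibi_field" where
  "divide_hibi_field h h' = h * inverse h'"

lemmas hibi_fract_simps =
  hibi_fract_inject[symmetric] zero_hibi_field.rep_eq one_hibi_field.rep_eq
  plus_hibi_field.rep_eq uminus_hibi_field.rep_eq times_hibi_field.rep_eq
  inverse_hibi_field.rep_eq

instance
proof
  fix a b c :: "'a hibi_field"
  show "a * b * c = a * (b * c)" unfolding hibi_fract_simps by (rule mult.assoc)
  show "a * b = b * a" unfolding hibi_fract_simps by (rule mult.commute)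
  show "1 * a = a" unfolding hibi_fract_simps by (rule mult_1_left)
  show "a + b + c = a + (b + c)" unfolding hibi_fract_simps by (rule add.assoc)
  show "a + b = b + a" unfolding hibi_fract_simps by (rule add.commute)
  show "0 + a = a" unfolding hibi_fract_simps by (rule add_0_left)
  show "- a + a = 0" unfolding hibi_fract_simps by (rule left_minus)
  show "a - b = a + - b" by (rule minus_hibi_field_def)
  show "(a + b) * c = a * c + b * c" unfolding hibi_fract_simps by (rule distrib_right)
  show "(0::'a hibi_field) \<noteq> 1" unfolding hibi_fract_simps by (rule zero_neq_one)
  show "inverse a * a = 1" if "a \<noteq> 0" using that unfolding hibi_fract_simps by (rule left_inverse)
  show "a div b = a * inverse b" by (rule divide_hibi_field_def)
  show "inverse (0::'a hibi_field) = 0" unfolding hibi_fract_simps by (rule inverse_zero)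
qed

end

lift_definition hibi_const :: "complex \<Rightarrow> 'a::{finite,distrib_lattice,bounded_lattice} hibi_field"
  is "\<lambda>c. Fract (hibi_class (Poly_Mapping.single 0 c)) 1"
  using hibi_homogeneous_const hibi_homogeneous_1 zero_neq_one by metis

lift_definition xhat :: "'a::{finite,distrib_lattice,bounded_lattice} \<Rightarrow> 'a hibi_field"
  is "\<lambda>l. Fract (hibi_gen l) (hibi_gen bot)"
  using hibi_homogeneous_gen hibi_gen_nonzero by metis


section \<open>The value group\<close>

text \<open>
  \<open>\<int>\<^sup>N\<close>, where \<open>N\<close> is the rank of the lattice \<^typ>\<open>'a\<close>. Vectors are functions on the
  coordinates \<open>1, \<dots>, N\<close>, extended by \<open>0\<close>.
\<close>

typedef (overloaded) 'a value_vec =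
  "{v :: nat \<Rightarrow> int.
     \<forall>i. i \<notin> {1..lattice_rank TYPE('a::{finite,distrib_lattice,bounded_lattice})} \<longrightarrow> v i = 0}"
  morphisms coord Abs_value_vec
  by (intro exI[of _ "\<lambda>_. 0"]) simp

setup_lifting type_definition_value_vec

lemma finite_coord_diff: "finite {i. coord a i \<noteq> coord b i}"
  for a b :: "'a::{finite,distrib_lattice,bounded_lattice} value_vec"
proof (rule finite_subset)
  have "coord a i = 0 \<and> coord b i = 0" if "i \<notin> {1..lattice_rank TYPE('a)}" for i
    using that coord[of a] coord[of b] by blast
  then show "{i. coord a i \<noteq> coord b i} \<subseteq> {1..lattice_rank TYPE('a)}"
    by (metis (mono_tags, lifting) mem_Collect_eq subsetI)
qed simp

lemma last_coord_diff:
  fixes a b :: "'a::{finite,distrib_lattice,bounded_lattice} value_vec"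
  assumes "a \<noteq> b"
  obtains i where "coord a i \<noteq> coord b i" "\<forall>j>i. coord a j = coord b j"
proof
  let ?D = "{i. coord a i \<noteq> coord b i}"
  have "?D \<noteq> {}" using assms by (auto simp: coord_inject[symmetric])
  then have "Max ?D \<in> ?D" by (intro Max_in finite_coord_diff)
  then show "coord a (Max ?D) \<noteq> coord b (Max ?D)" by simp
  show "\<forall>j > Max ?D. coord a j = coord b j"
    using Max_ge[OF finite_coord_diff, of _ a b] by force
qed

instantiation value_vec :: ("{finite,distrib_lattice,bounded_lattice}") linordered_ab_group_add
begin

lift_definition zero_value_vec :: "'a value_vec" is "\<lambda>_. 0" by simp
lift_definition plus_value_vec :: "'a value_vec \<Rightarrow> 'a value_vec \<Rightarrow> 'a value_vec"
  is "\<lambda>v w i. v i + w i" by simp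
lift_definition minus_value_vec :: "'a value_vec \<Rightarrow> 'a value_vec \<Rightarrow> 'a value_vec"
  is "\<lambda>v w i. v i - w i" by simp
lift_definition uminus_value_vec :: "'a value_vec \<Rightarrow> 'a value_vec"
  is "\<lambda>v i. - v i" by simp

text \<open>The reverse lexicographic order: the last differing coordinate decides.\<close>

definition less_value_vec :: "'a value_vec \<Rightarrow> 'a value_vec \<Rightarrow> bool" where
  "less_value_vec b a \<longleftrightarrow> (\<exists>i. coord (a - b) i > 0 \<and> (\<forall>j>i. coord (a - b) j = 0))"
definition less_eq_value_vec :: "'a value_vec \<Rightarrow> 'a value_vec \<Rightarrow> bool" where
  "less_eq_value_vec b a \<longleftrightarrow> b < a \<or> b = a"

instance
proof
  fix a b c :: "'a value_vec"
  have less_iff: "x < y \<longleftrightarrow> (\<exists>i. coord x i < coord y i \<and> (\<forall>j>i. coord y j = coord x j))"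
    for x y :: "'a value_vec"
    by (simp add: less_value_vec_def minus_value_vec.rep_eq)
  have irrefl: "\<not> x < x" for x :: "'a value_vec" by (simp add: less_iff)
  have trans: "x < z" if xy: "x < y" and yz: "y < z" for x y z :: "'a value_vec"
  proof -
    obtain i where i: "coord x i < coord y i" "\<forall>j>i. coord y j = coord x j"
      using xy less_iff by blast
    obtain k where k: "coord y k < coord z k" "\<forall>j>k. coord z j = coord y j"
      using yz less_iff by blast
    show ?thesis unfolding less_iff
    proof (intro exI[of _ "max i k"] conjI)
      show "coord x (max i k) < coord z (max i k)"
        using i k by (cases i k rule: linorder_cases) (auto simp: max_def)
    qed (use i k in auto)
  qed
  show "a + b + c = a + (b + c)" by transfer auto
  show "a + b = b + a" by transfer auto
  show "0 + a = a" by transfer auto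
  show "- a + a = 0" by transfer auto
  show "a - b = a + - b" by transfer auto
  show "(a < b) = (a \<le> b \<and> \<not> b \<le> a)"
    unfolding less_eq_value_vec_def by (metis irrefl trans)
  show "a \<le> a" by (simp add: less_eq_value_vec_def)
  show "a \<le> c" if "a \<le> b" "b \<le> c"
    using that unfolding less_eq_value_vec_def by (metis trans)
  show "a = b" if "a \<le> b" "b \<le> a"
    using that unfolding less_eq_value_vec_def by (metis irrefl trans)
  show "c + a \<le> c + b" if "a \<le> b"
    using that by (auto simp: less_eq_value_vec_def less_iff plus_value_vec.rep_eq)
  show "a \<le> b \<or> b \<le> a"
  proof (cases "a = b")
    case False
    then obtain i where "coord a i \<noteq> coord b i" "\<forall>j>i. coord a j = coord b j"
      by (rule last_coord_diff)
    then show ?thesis unfolding less_eq_value_vec_def less_iff by (metis linorder_neqE)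
  qed (simp add: less_eq_value_vec_def)
qed

end

lift_definition unit_vec :: "nat \<Rightarrow> 'a::{finite,distrib_lattice,bounded_lattice} value_vec"
  is "\<lambda>i j. if j = i \<and> i \<in> {1..lattice_rank TYPE('a)} then 1 else 0" by auto

lift_definition scale_vec ::
  "int \<Rightarrow> 'a::{finite,distrib_lattice,bounded_lattice} value_vec \<Rightarrow> 'a value_vec"
  is "\<lambda>c v i. c * v i" by simp


section \<open>The valuations\<close>

definition chain_vec ::
  "'a::{finite,distrib_lattice,bounded_lattice} set \<Rightarrow> nat \<Rightarrow> 'a value_vec" where
  "chain_vec C j =
    (\<Sum>i | i \<in> {1..lattice_rank TYPE('a)} \<and> chain_irr C i \<in> Spec_star (chain_elem C j). unit_vec i)"

definition chain_polys ::
  "'a::{finite,distrib_lattice,bounded_lattice} itself \<Rightarrow> ((nat \<Rightarrow>\<^sub>0 nat) \<Rightarrow>\<^sub>0 complex) set" where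
  "chain_polys _ = {p. \<forall>a\<in>Poly_Mapping.keys p. Poly_Mapping.keys a \<subseteq> {1..lattice_rank TYPE('a)}}"

definition chain_eval ::
  "'a::{finite,distrib_lattice,bounded_lattice} set \<Rightarrow> ((nat \<Rightarrow>\<^sub>0 nat) \<Rightarrow>\<^sub>0 complex) \<Rightarrow> 'a hibi_field" where
  "chain_eval C = poly_eval hibi_const (\<lambda>j. xhat (chain_elem C j))"

definition poly_val ::
  "'a::{finite,distrib_lattice,bounded_lattice} set \<Rightarrow> ((nat \<Rightarrow>\<^sub>0 nat) \<Rightarrow>\<^sub>0 complex) \<Rightarrow> 'a value_vec" where
  "poly_val C p =
    Min ((\<lambda>a. \<Sum>j = 1..lattice_rank TYPE('a). scale_vec (int (Poly_Mapping.lookup a j)) (chain_vec C j)) ` Poly_Mapping.keys p)"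

text \<open>The values of the following two functions at \<open>0\<close> carry no meaning.\<close>

definition chain_val ::
  "'a::{finite,distrib_lattice,bounded_lattice} set \<Rightarrow> 'a hibi_field \<Rightarrow> 'a value_vec" where
  "chain_val C h = (THE u. \<exists>p q. p \<in> chain_polys TYPE('a) \<and> q \<in> chain_polys TYPE('a) \<and>
     p \<noteq> 0 \<and> q \<noteq> 0 \<and> h = chain_eval C p / chain_eval C q \<and> u = poly_val C p - poly_val C q)"

definition spec_val ::
  "'a::{finite,distrib_lattice,bounded_lattice} hibi_field \<Rightarrow> 'a value_vec" where
  "spec_val h = Min ((\<lambda>C. chain_val C h) ` max_chains)"


section \<open>Standard monomials\<close>

definition xhat_monomial ::
  "nat \<Rightarrow> (nat \<Rightarrow> 'a::{finite,distrib_lattice,bounded_lattice}) \<Rightarrow> (nat \<Rightarrow> nat) \<Rightarrow> 'a hibi_field" where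
  "xhat_monomial k l n = (\<Prod>j = 1..k. xhat (l j) ^ n j)"

text \<open>
  Being standard is a property of the list of indices of a monomial with nonzero exponents,
  not of the element of the function field it represents.
\<close>

definition standard_indices :: "nat \<Rightarrow> (nat \<Rightarrow> 'a::order) \<Rightarrow> bool" where
  "standard_indices k l \<longleftrightarrow>
    (\<exists>\<pi>. \<pi> permutes {1..k} \<and> (\<forall>i\<in>{1..k}. \<forall>j\<in>{1..k}. i \<le> j \<longrightarrow> l (\<pi> j) \<le> l (\<pi> i)))"

end

theory Submission
  imports Defs
begin

text \<open>
  A maximal chain \<open>C\<close> enumerates the non-minimal join-irreducibles as \<open>m\<^sub>1, \<dots>, m\<^sub>N\<close>, and the
  \<open>i\<close>-th coordinate of the \<open>C\<close>-valuation of a monomial counts, with multiplicity, the indices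
  above \<open>m\<^sub>i\<close>. So for a single \<open>l\<close> the valuation is a 0/1-vector whose number of ones does not
  depend on \<open>C\<close>. In the reverse lexicographic order it is minimal iff the ones form an initial
  segment, which means \<open>l \<in> C\<close>. Since each \<open>C\<close>-valuation is additive on monomials, its value at a
  monomial is at least the sum of the minimal values of the factors, with equality iff all indices
  lie in \<open>C\<close>; such a \<open>C\<close> exists iff the indices are pairwise comparable.
\<close>


section \<open>Maximal chains\<close>

lemma Spec_subset_iff:
  fixes s t :: "'a::{finite,lattice}"
  shows "Spec s \<subseteq> Spec t \<longleftrightarrow> s \<le> t"
  using join_irreducible_le[of s t] by (auto simp: Spec_def intro: order.trans)

lemma Spec_eq_iff:
  fixes s t :: "'a::{finite,lattice}"
  shows "Spec s = Spec t \<longleftrightarrow> s = t"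
  using Spec_subset_iff[of s t] Spec_subset_iff[of t s] by auto

lemma Spec_sup:
  fixes s t :: "'a::distrib_lattice"
  shows "Spec (sup s t) = Spec s \<union> Spec t"
  by (auto simp: Spec_def join_irreducible_prime)

lemma bot_in_Spec: "(bot :: 'a::bounded_lattice) \<in> Spec s"
  by (simp add: Spec_def join_irreducible_bot)

text \<open>The rank function of the lattice. It gives the position of an element in every maximal
  chain through it (\<open>card_below_eq_rk\<close>), so positions do not depend on the
  chain.\<close>

definition rk :: "'a::bounded_lattice \<Rightarrow> nat" where
  "rk s = card (Spec_star s)"

lemma rk_less:
  fixes s t :: "'a::{finite,bounded_lattice}"
  assumes "s < t"
  shows "rk s < rk t"
proof -
  have "Spec s \<subset> Spec t"
    using assms Spec_subset_iff[of s t] Spec_eq_iff[of s t] by (auto simp: less_le)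
  then have "Spec_star s \<subset> Spec_star t"
    using bot_in_Spec[of s] by (auto simp: Spec_star_def)
  then show ?thesis unfolding rk_def by (intro psubset_card_mono) auto
qed

lemma rk_bot: "rk (bot :: 'a::bounded_lattice) = 0"
proof -
  have "Spec_star (bot :: 'a) = {}"
    by (auto simp: Spec_star_def Spec_def intro: bot.extremum_uniqueI)
  then show ?thesis by (simp add: rk_def)
qed

lemma rk_top: "rk (top :: 'a::{finite,bounded_lattice}) = lattice_rank TYPE('a)"
  by (simp add: rk_def Spec_star_def Spec_def lattice_rank_def join_irreducible_bot)

lemma rk_le: "rk (s :: 'a::{finite,bounded_lattice}) \<le> lattice_rank TYPE('a)"
  unfolding rk_top[symmetric] rk_def
  by (rule card_mono) (auto simp: Spec_star_def Spec_def)

section \<open>Maximality and extension of chains\<close>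

lemma chain_less_iff:
  fixes A :: "'a::order set"
  shows "pred_on.chain UNIV (<) A \<longleftrightarrow> (\<forall>x\<in>A. \<forall>y\<in>A. x \<le> y \<or> y \<le> x)"
  unfolding pred_on.chain_def by (auto simp: less_le)

lemma max_chains_iff:
  fixes C :: "'a::order set"
  shows "C \<in> max_chains \<longleftrightarrow> pred_on.chain UNIV (<) C \<and> \<not> (\<exists>S. pred_on.chain UNIV (<) S \<and> C \<subset> S)"
  by (simp add: max_chains_def pred_on.maxchain_def)

lemma max_chains_comparable:
  fixes C :: "'a::order set"
  assumes "C \<in> max_chains" "x \<in> C" "y \<in> C"
  shows "x \<le> y \<or> y \<le> x"
  using assms unfolding max_chains_iff chain_less_iff by blast

text \<open>Otherwise inserting \<open>x\<close> would give a strictly larger chain.\<close>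

lemma max_chains_memI:
  fixes C :: "'a::order set"
  assumes C: "C \<in> max_chains" and x: "\<And>y. y \<in> C \<Longrightarrow> x \<le> y \<or> y \<le> x"
  shows "x \<in> C"
proof (rule ccontr)
  assume "x \<notin> C"
  moreover have "pred_on.chain UNIV (<) (insert x C)"
    using max_chains_comparable[OF C] x unfolding chain_less_iff by blast
  ultimately show False
    using C unfolding max_chains_iff by blast
qed

lemma chain_extends_to_max_chain:
  fixes A :: "'a::{finite,order} set"
  assumes "\<And>x y. x \<in> A \<Longrightarrow> y \<in> A \<Longrightarrow> x \<le> y \<or> y \<le> x"
  obtains C where "C \<in> max_chains" "A \<subseteq> C"
proof -
  let ?S = "{B. A \<subseteq> B \<and> pred_on.chain UNIV (<) B}"
  have "A \<in> ?S" using assms by (simp add: chain_less_iff)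
  then obtain C where C: "C \<in> ?S" "\<And>B. B \<in> ?S \<Longrightarrow> C \<subseteq> B \<Longrightarrow> C = B"
    using finite_has_maximal[of ?S] by auto
  then have "C \<in> max_chains"
    unfolding max_chains_iff by blast
  with C(1) that show ?thesis by blast
qed

lemma max_chains_nonempty: "(max_chains :: 'a::{finite,order} set set) \<noteq> {}"
  using chain_extends_to_max_chain[of "{} :: 'a set"] by blast

section \<open>Enumerations along a fixed maximal chain\<close>

context
  fixes C :: "'a::{finite,distrib_lattice,bounded_lattice} set"
  assumes C: "C \<in> max_chains"
begin

lemma rk_less_iff:
  assumes "x \<in> C" "y \<in> C"
  shows "rk x < rk y \<longleftrightarrow> x < y"
  using max_chains_comparable[OF C assms] rk_less[of x y] rk_less[of y x]
  by (metis less_irrefl less_le order.strict_trans)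

lemma rk_inj_on: "inj_on rk C"
  using rk_less_iff max_chains_comparable[OF C] by (metis inj_onI less_irrefl less_le)

text \<open>Induction upwards from \<open>bot\<close>: passing from an element of \<open>C\<close>
  to its successor in \<open>C\<close> adds exactly one join-irreducible to the spectrum, so no rank
  is skipped.\<close>

lemma ex_rk: "i \<le> lattice_rank TYPE('a) \<Longrightarrow> \<exists>c\<in>C. rk c = i"
proof (induction i)
  case 0
  have "bot \<in> C" by (rule max_chains_memI[OF C]) simp
  then show ?case using rk_bot by blast
next
  case (Suc i)
  then obtain c where c: "c \<in> C" "rk c = i" by auto
  have "c \<noteq> top" using Suc(2) c rk_top by (metis Suc_n_not_le_n)
  moreover have "top \<in> C" by (rule max_chains_memI[OF C]) simp
  \<comment> \<open>\<open>d\<close> is the successor of \<open>c\<close> in \<open>C\<close>.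
    Below, \<open>m\<close> is a minimal join-irreducible that is new in \<open>d\<close>, so
    everything else in \<open>Spec m\<close> already lies in \<open>Spec c\<close>.\<close>
  ultimately obtain d where d: "d \<in> C" "c < d" "\<And>e. e \<in> C \<Longrightarrow> c < e \<Longrightarrow> e \<le> d \<Longrightarrow> d = e"
    using finite_has_minimal[of "{d \<in> C. c < d}"] by (auto simp: top.not_eq_extremum)
  have "\<not> Spec d \<subseteq> Spec c" using d(2) by (simp add: Spec_subset_iff less_le_not_le)
  then obtain m where m: "m \<in> Spec d - Spec c"
    "\<And>m'. m' \<in> Spec d - Spec c \<Longrightarrow> m' \<le> m \<Longrightarrow> m = m'"
    using finite_has_minimal[of "Spec d - Spec c"] by auto
  have le: "sup c m \<le> d" using d(2) m(1) by (auto simp: Spec_def)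
  have less: "c < sup c m" using m(1) by (auto simp: Spec_def less_le le_iff_sup sup_commute)
  \<comment> \<open>Every element of \<open>C\<close> is at most \<open>c\<close> or at least
    \<open>d\<close>, and \<open>sup c m\<close> lies between these two. Maximality puts it into
    \<open>C\<close>, and so it must be \<open>d\<close>.\<close>
  have "sup c m \<in> C"
  proof (rule max_chains_memI[OF C])
    fix y assume y: "y \<in> C"
    have "y \<le> c \<or> d \<le> y"
      using max_chains_comparable[OF C y c(1)] max_chains_comparable[OF C y d(1)] d(3)[OF y]
      by (auto simp: less_le)
    then show "sup c m \<le> y \<or> y \<le> sup c m" using le by (auto intro: order.trans le_supI1)
  qed
  then have "d = sup c m" using d(3) less le by blast
  then have "Spec d = insert m (Spec c)"
    using m by (auto simp: Spec_sup) (auto simp: Spec_def)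
  moreover have "m \<noteq> bot" using m(1) bot_in_Spec[of c] by auto
  ultimately have "Spec_star d = insert m (Spec_star c)" "m \<notin> Spec_star c"
    using m(1) by (auto simp: Spec_star_def)
  then have "rk d = Suc i" using c(2) by (simp add: rk_def)
  with d(1) show ?case by blast
qed

text \<open>By \<open>ex_rk\<close>, \<open>rk\<close> maps the elements of \<open>C\<close> below
  \<open>c\<close> bijectively onto the numbers below \<open>rk c\<close>. This links the counting
  in \<open>chain_elem\<close> to the rank.\<close>

lemma card_below_eq_rk:
  assumes "c \<in> C"
  shows "card {d \<in> C. d < c} = rk c"
proof -
  have "rk ` {d \<in> C. d < c} = {..<rk c}"
  proof (intro equalityI subsetI)
    fix i assume "i \<in> {..<rk c}"
    then obtain d where "d \<in> C" "rk d = i" using ex_rk[of i] rk_le[of c] by auto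
    then show "i \<in> rk ` {d \<in> C. d < c}"
      using \<open>i \<in> _\<close> rk_less_iff[of d c] assms by auto
  qed (auto intro: rk_less)
  moreover have "inj_on rk {d \<in> C. d < c}" by (rule inj_on_subset[OF rk_inj_on]) auto
  ultimately show ?thesis by (metis card_image card_lessThan)
qed

lemma chain_elem:
  assumes "i \<le> lattice_rank TYPE('a)"
  shows "chain_elem C i \<in> C" "rk (chain_elem C i) = i"
proof -
  obtain c where c: "c \<in> C" "rk c = i" using ex_rk[OF assms] by blast
  have "chain_elem C i = c"
    unfolding chain_elem_def
  proof (rule the_equality)
    show "c \<in> C \<and> card {d \<in> C. d < c} = i" using c card_below_eq_rk by simp
    show "x = c" if "x \<in> C \<and> card {d \<in> C. d < x} = i" for x
      using that c card_below_eq_rk rk_inj_on by (metis inj_onD)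
  qed
  with c show "chain_elem C i \<in> C" "rk (chain_elem C i) = i" by simp_all
qed

lemma chain_elem_le_iff:
  assumes "i \<le> lattice_rank TYPE('a)" "j \<le> lattice_rank TYPE('a)"
  shows "chain_elem C i \<le> chain_elem C j \<longleftrightarrow> i \<le> j"
proof -
  note ij = chain_elem[OF assms(1)] chain_elem[OF assms(2)]
  have "\<not> chain_elem C j < chain_elem C i \<longleftrightarrow> i \<le> j"
    using rk_less_iff[OF ij(3,1)] ij(2,4) by auto
  then show ?thesis using max_chains_comparable[OF C ij(1,3)] by (auto simp: less_le)
qed

lemma chain_elem_rk: "c \<in> C \<Longrightarrow> chain_elem C (rk c) = c"
  using chain_elem[OF rk_le] rk_inj_on by (metis inj_onD)

text \<open>Consecutive chain elements have ranks differing by one, so the difference of their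
  spectra is a singleton and the definite description in \<open>chain_irr\<close> is
  meaningful.\<close>

lemma chain_irr_mem:
  assumes "i \<in> {1..lattice_rank TYPE('a)}"
  shows "chain_irr C i \<in> Spec (chain_elem C i) - Spec (chain_elem C (i - 1))"
proof -
  let ?c = "chain_elem C i" and ?b = "chain_elem C (i - 1)"
  have "?b \<le> ?c" using assms by (subst chain_elem_le_iff) auto
  then have "Spec_star ?b \<subseteq> Spec_star ?c" by (auto simp: Spec_star_def Spec_def)
  then have "card (Spec_star ?c - Spec_star ?b) = rk ?c - rk ?b"
    unfolding rk_def by (intro card_Diff_subset) auto
  also have "\<dots> = 1" using assms chain_elem(2)[of i] chain_elem(2)[of "i - 1"] by auto
  also have "Spec_star ?c - Spec_star ?b = Spec ?c - Spec ?b"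
    using bot_in_Spec[of ?b] by (auto simp: Spec_star_def)
  finally obtain m where "Spec ?c - Spec ?b = {m}" by (auto simp: card_1_singleton_iff)
  then show ?thesis by (simp add: chain_irr_def)
qed

lemma chain_irr_irreducible:
  assumes "i \<in> {1..lattice_rank TYPE('a)}"
  shows "join_irreducible (chain_irr C i)" "chain_irr C i \<noteq> bot"
  using chain_irr_mem[OF assms] by (auto simp: Spec_def join_irreducible_bot)

text \<open>If \<open>j < i\<close>, then \<open>chain_elem C j\<close> lies below
  \<open>chain_elem C (i - 1)\<close>, whose spectrum misses \<open>chain_irr C i\<close>; if
  \<open>i \<le> j\<close>, it lies above \<open>chain_elem C i\<close>.\<close>

lemma chain_irr_le_chain_elem_iff:
  assumes "i \<in> {1..lattice_rank TYPE('a)}" "j \<le> lattice_rank TYPE('a)"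
  shows "chain_irr C i \<le> chain_elem C j \<longleftrightarrow> i \<le> j"
proof
  assume le: "chain_irr C i \<le> chain_elem C j"
  show "i \<le> j"
  proof (rule ccontr)
    assume "\<not> i \<le> j"
    then have "chain_elem C j \<le> chain_elem C (i - 1)"
      using assms by (subst chain_elem_le_iff) auto
    with le chain_irr_mem[OF assms(1)] show False by (auto simp: Spec_def)
  qed
next
  assume "i \<le> j"
  then have "chain_elem C i \<le> chain_elem C j" using assms by (subst chain_elem_le_iff) auto
  then show "chain_irr C i \<le> chain_elem C j"
    using chain_irr_mem[OF assms(1)] by (auto simp: Spec_def)
qed

text \<open>Injectivity holds because the first chain element above \<open>chain_irr C i\<close> has
  index \<open>i\<close>; surjectivity follows by comparing cardinalities.\<close>

lemma chain_irr_bij_betw: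
  "bij_betw (chain_irr C) {1..lattice_rank TYPE('a)} (Spec_star top)"
proof -
  let ?I = "{1..lattice_rank TYPE('a)}"
  have inj: "inj_on (chain_irr C) ?I"
  proof (rule inj_onI)
    fix i j assume ij: "i \<in> ?I" "j \<in> ?I" and eq: "chain_irr C i = chain_irr C j"
    show "i = j"
    proof (rule antisym)
      show "i \<le> j"
        using chain_irr_le_chain_elem_iff[of i j] chain_irr_le_chain_elem_iff[of j j] ij eq by simp
      show "j \<le> i"
        using chain_irr_le_chain_elem_iff[of j i] chain_irr_le_chain_elem_iff[of i i] ij eq by simp
    qed
  qed
  moreover have "chain_irr C ` ?I \<subseteq> Spec_star top"
    using chain_irr_irreducible by (auto simp: Spec_star_def Spec_def)
  then have "chain_irr C ` ?I = Spec_star top"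
    using card_image[OF inj] rk_top[where 'a = 'a] by (intro card_subset_eq) (simp_all add: rk_def)
  ultimately show ?thesis by (simp add: bij_betw_def)
qed

end


section \<open>Monomials in the function field\<close>

text \<open>For join-irreducible \<open>m\<close>, the exponent of the variable of \<open>m\<close>
  in the image of the monomial under \<open>spec_hom\<close> (\<open>lookup_spec_weight\<close>). At
  \<open>bot\<close> it is the total degree of the monomial.\<close>

definition spec_count :: "('a::{finite,ord} \<Rightarrow>\<^sub>0 nat) \<Rightarrow> 'a \<Rightarrow> nat" where
  "spec_count a m = (\<Sum>l\<in>UNIV. Poly_Mapping.lookup a l * of_bool (m \<le> l))"

definition xmon :: "('a::{finite,distrib_lattice,bounded_lattice} \<Rightarrow>\<^sub>0 nat) \<Rightarrow> 'a hibi_field" where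
  "xmon a = (\<Prod>l\<in>UNIV. xhat l ^ Poly_Mapping.lookup a l)"

lemma spec_count_0: "spec_count 0 m = 0"
  by (simp add: spec_count_def)

lemma spec_count_add: "spec_count (a + b) m = spec_count a m + spec_count b m"
  by (simp add: spec_count_def lookup_add sum.distrib algebra_simps)

lemma spec_count_sum: "spec_count (sum f A) m = (\<Sum>i\<in>A. spec_count (f i) m)"
  by (induction A rule: infinite_finite_induct) (simp_all add: spec_count_0 spec_count_add)

lemma spec_count_single: "spec_count (Poly_Mapping.single l e) m = e * of_bool (m \<le> l)"
proof -
  have "spec_count (Poly_Mapping.single l e) m = (\<Sum>k\<in>UNIV. if l = k then e * of_bool (m \<le> l) else 0)"
    unfolding spec_count_def by (intro sum.cong) (auto simp: lookup_single)
  then show ?thesis by simp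
qed

lemma lookup_spec_weight:
  assumes "join_irreducible m"
  shows "Poly_Mapping.lookup (spec_weight a) (to_nat m) = spec_count a m"
proof -
  obtain xs where a: "a = mon_list xs" using ex_mon_list by blast
  have "spec_count (mon_list xs) m = length (filter (\<lambda>x. m \<le> x) xs)"
    by (induction xs)
      (simp_all add: mon_list_def spec_count_0 spec_count_add spec_count_single del: single_one)
  then show ?thesis by (simp add: a lookup_spec_weight_mon_list[OF assms])
qed

lemma lookup_spec_weight_outside:
  fixes a :: "'a::{finite,distrib_lattice,bounded_lattice} \<Rightarrow>\<^sub>0 nat"
  assumes "\<And>m::'a. join_irreducible m \<Longrightarrow> i \<noteq> to_nat m"
  shows "Poly_Mapping.lookup (spec_weight a) i = 0"
proof -
  have "Poly_Mapping.lookup (spec_mon l) i = 0" for l :: 'a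
    unfolding spec_mon_def lookup_sum using assms
    by (intro sum.neutral) (auto simp: lookup_single when_def Spec_def)
  moreover obtain xs where a: "a = mon_list xs" using ex_mon_list by blast
  ultimately show ?thesis unfolding a
    by (induction xs) (simp_all add: mon_list_def spec_weight_0 spec_weight_add spec_weight_single lookup_add)
qed

lemma spec_weight_eq_iff:
  "spec_weight a = spec_weight b \<longleftrightarrow> (\<forall>m. join_irreducible m \<longrightarrow> spec_count a m = spec_count b m)"
proof
  assume eq: "\<forall>m. join_irreducible m \<longrightarrow> spec_count a m = spec_count b m"
  show "spec_weight a = spec_weight b"
  proof (rule poly_mapping_eqI)
    fix i
    show "Poly_Mapping.lookup (spec_weight a) i = Poly_Mapping.lookup (spec_weight b) i"
    proof (cases "\<exists>m::'a. join_irreducible m \<and> i = to_nat m")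
      case True
      then obtain m :: 'a where "join_irreducible m" "i = to_nat m" by blast
      then show ?thesis using eq by (simp add: lookup_spec_weight)
    next
      case False
      then show ?thesis using lookup_spec_weight_outside[of i] by metis
    qed
  qed
qed (metis lookup_spec_weight)

lemma xmon_0: "xmon 0 = 1"
  by (simp add: xmon_def)

lemma xmon_add: "xmon (a + b) = xmon a * xmon b"
  by (simp add: xmon_def lookup_add power_add prod.distrib)

lemma xmon_sum: "xmon (sum f A) = (\<Prod>i\<in>A. xmon (f i))"
  by (induction A rule: infinite_finite_induct) (simp_all add: xmon_0 xmon_add)

lemma xmon_single: "xmon (Poly_Mapping.single l e) = xhat l ^ e"
proof -
  have "xmon (Poly_Mapping.single l e) = (\<Prod>k\<in>UNIV. if l = k then xhat l ^ e else 1)"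
    unfolding xmon_def by (intro prod.cong) (auto simp: lookup_single)
  then show ?thesis by simp
qed

lemma xhat_bot: "xhat bot = 1"
  by (simp add: hibi_fract_simps xhat.rep_eq One_fract_def eq_fract hibi_gen_nonzero)

text \<open>Each factor \<open>xhat l\<close> contributes one generator at \<open>bot\<close> to the
  denominator, and the count at \<open>bot\<close> is the number of factors.\<close>

lemma hibi_fract_xmon:
  "hibi_fract (xmon a) =
    Fract (hibi_class (Poly_Mapping.single a 1)) (hibi_gen bot ^ spec_count a bot)"
proof -
  obtain xs where a: "a = mon_list xs" using ex_mon_list by blast
  show ?thesis unfolding a
  proof (induction xs)
    case Nil
    show ?case
      by (simp add: mon_list_def xmon_0 spec_count_0 one_hibi_field.rep_eq One_fract_def one_hibi_ring_def)
  next
    case (Cons x xs)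
    have eq: "mon_list (x # xs) = Poly_Mapping.single x 1 + mon_list xs"
      by (simp add: mon_list_def)
    have "hibi_class (Poly_Mapping.single (Poly_Mapping.single x 1 + mon_list xs) 1) =
      hibi_gen x * hibi_class (Poly_Mapping.single (mon_list xs) 1)"
      by (simp add: hibi_gen_def var_def mult_single flip: hibi_class_mult)
    then show ?case
      unfolding eq xmon_add times_hibi_field.rep_eq Cons xmon_single
      by (simp add: xhat.rep_eq spec_count_add spec_count_single del: single_one)
  qed
qed

text \<open>Multiplying by a power of the generator at \<open>bot\<close> makes all monomials have degree \<open>D\<close>.\<close>

definition homogenization ::
  "nat \<Rightarrow> ('a::{finite,bounded_lattice} \<Rightarrow>\<^sub>0 nat) \<Rightarrow> ('a \<Rightarrow>\<^sub>0 nat)" where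
  "homogenization D a = a + Poly_Mapping.single bot (D - spec_count a bot)"

lemma hibi_fract_xmon_homogenization:
  assumes "spec_count a bot \<le> D"
  shows "hibi_fract (xmon a) =
    Fract (hibi_class (Poly_Mapping.single (homogenization D a) 1)) (hibi_gen bot ^ D)"
proof -
  have "xmon a = xmon (homogenization D a)"
    by (simp add: homogenization_def xmon_add xmon_single xhat_bot)
  moreover have "spec_count (homogenization D a) bot = D"
    using assms by (simp add: homogenization_def spec_count_add spec_count_single)
  ultimately show ?thesis by (simp add: hibi_fract_xmon)
qed

lemma spec_count_homogenization:
  assumes "join_irreducible m" "m \<noteq> bot"
  shows "spec_count (homogenization D a) m = spec_count a m"
  using assms by (auto simp: homogenization_def spec_count_add spec_count_single bot_unique)

lemma spec_weight_homogenization_eq: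
  assumes "spec_count a bot \<le> D" "spec_count b bot \<le> D"
  shows "spec_weight (homogenization D a) = spec_weight (homogenization D b) \<longleftrightarrow>
    (\<forall>m. join_irreducible m \<and> m \<noteq> bot \<longrightarrow> spec_count a m = spec_count b m)"
proof -
  have "spec_count (homogenization D a) bot = spec_count (homogenization D b) bot"
    using assms by (simp add: homogenization_def spec_count_add spec_count_single)
  then show ?thesis
    unfolding spec_weight_eq_iff by (metis spec_count_homogenization)
qed

text \<open>After homogenization to a common degree the counts at \<open>bot\<close> agree as well,
  so the numerators have equal weight and are congruent modulo the Hibi ideal, over the same
  denominator.\<close>

lemma xmon_eqI:
  assumes "\<And>m. join_irreducible m \<Longrightarrow> m \<noteq> bot \<Longrightarrow> spec_count a m = spec_count b m"
  shows "xmon a = xmon b"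
proof -
  define D where "D = spec_count a bot + spec_count b bot"
  have D: "spec_count a bot \<le> D" "spec_count b bot \<le> D" by (simp_all add: D_def)
  have "mon_equiv (homogenization D a) (homogenization D b)"
    using assms by (intro weight_mon_equiv) (simp add: spec_weight_homogenization_eq[OF D])
  then show ?thesis
    unfolding mon_equiv_def hibi_ring.abs_eq_iff[symmetric] hibi_fract_inject[symmetric]
    by (simp add: hibi_fract_xmon_homogenization[OF D(1)] hibi_fract_xmon_homogenization[OF D(2)])
qed

section \<open>Linear independence of monomials\<close>

lemma hibi_fract_sum: "hibi_fract (sum f A) = (\<Sum>i\<in>A. hibi_fract (f i))"
  by (induction A rule: infinite_finite_induct)
    (simp_all add: zero_hibi_field.rep_eq plus_hibi_field.rep_eq)

lemma Fract_sum:
  assumes "d \<noteq> 0"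
  shows "(\<Sum>i\<in>A. Fract (f i) d) = Fract (sum f A) d"
proof (induction A rule: infinite_finite_induct)
  case (insert x A)
  have "Fract (f x) d + Fract (sum f A) d = Fract (d * (f x + sum f A)) (d * d)"
    using assms by (simp add: distrib_left mult.commute)
  also have "\<dots> = Fract (f x + sum f A) d" using assms by (rule mult_fract_cancel)
  finally show ?case using insert by simp
qed (use assms in \<open>simp_all add: fract_collapse\<close>)

lemma hibi_class_sum: "hibi_class (sum f A) = (\<Sum>i\<in>A. hibi_class (f i))"
  by (induction A rule: infinite_finite_induct) (simp_all add: zero_hibi_ring_def hibi_class_add)

lemma hibi_const_add: "hibi_const (c + d) = hibi_const c + hibi_const d"
  by (simp add: hibi_fract_simps hibi_const.rep_eq single_add hibi_class_add)

lemma hibi_const_1: "hibi_const 1 = 1"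
  by (simp add: hibi_fract_simps hibi_const.rep_eq One_fract_def one_hibi_ring_def)

text \<open>Clearing a common denominator turns the relation into one in the Hibi ring. Since the
  ideal is the kernel of \<open>spec_hom\<close>, it becomes a relation between monomials of a
  polynomial ring, and these are pairwise distinct by the injectivity assumption.\<close>

lemma xmon_independent:
  fixes g :: "'i \<Rightarrow> ('a::{finite,distrib_lattice,bounded_lattice} \<Rightarrow>\<^sub>0 nat)"
  assumes "finite A"
    and inj: "\<And>x y. x \<in> A \<Longrightarrow> y \<in> A \<Longrightarrow>
      (\<And>m. join_irreducible m \<Longrightarrow> m \<noteq> bot \<Longrightarrow> spec_count (g x) m = spec_count (g y) m) \<Longrightarrow> x = y"
    and 0: "(\<Sum>x\<in>A. hibi_const (c x) * xmon (g x)) = 0"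
    and y: "y \<in> A"
  shows "c y = 0"
proof -
  define D where "D = (\<Sum>x\<in>A. spec_count (g x) bot)"
  define h where "h x = homogenization D (g x)" for x
  have D: "spec_count (g x) bot \<le> D" if "x \<in> A" for x
    unfolding D_def using that \<open>finite A\<close> by (intro member_le_sum) auto
  have nz: "hibi_gen (bot::'a) ^ D \<noteq> 0" by (simp add: hibi_gen_nonzero)
  have term_eq: "hibi_fract (hibi_const (c x) * xmon (g x)) =
      Fract (hibi_class (Poly_Mapping.single (h x) (c x))) (hibi_gen bot ^ D)" if "x \<in> A" for x
    using D[OF that]
    by (simp add: times_hibi_field.rep_eq hibi_const.rep_eq hibi_fract_xmon_homogenization h_def
        mult_single flip: hibi_class_mult)
  have "0 = hibi_fract (\<Sum>x\<in>A. hibi_const (c x) * xmon (g x))"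
    unfolding 0 by (simp add: zero_hibi_field.rep_eq)
  also have "\<dots> = (\<Sum>x\<in>A. Fract (hibi_class (Poly_Mapping.single (h x) (c x))) (hibi_gen bot ^ D))"
    unfolding hibi_fract_sum by (intro sum.cong refl term_eq)
  also have "\<dots> = Fract (hibi_class (\<Sum>x\<in>A. Poly_Mapping.single (h x) (c x))) (hibi_gen bot ^ D)"
    unfolding Fract_sum[OF nz] hibi_class_sum ..
  finally have "hibi_class (\<Sum>x\<in>A. Poly_Mapping.single (h x) (c x)) = 0"
    using nz by (simp add: Zero_fract_def eq_fract)
  then have "(\<Sum>x\<in>A. Poly_Mapping.single (spec_weight (h x)) (c x)) = 0"
    by (simp add: hibi_class_eq_0_iff hibi_ideal_iff spec_hom_sum spec_hom_single)
  then have "0 = Poly_Mapping.lookup (\<Sum>x\<in>A. Poly_Mapping.single (spec_weight (h x)) (c x)) (spec_weight (h y))"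
    by simp
  also have "\<dots> = (\<Sum>x\<in>A. if x = y then c x else 0)"
    unfolding lookup_sum
  proof (intro sum.cong refl)
    fix x assume x: "x \<in> A"
    have "spec_weight (h x) = spec_weight (h y) \<longleftrightarrow> x = y"
      unfolding h_def spec_weight_homogenization_eq[OF D[OF x] D[OF y]] using inj[OF x y] by blast
    then show "Poly_Mapping.lookup (Poly_Mapping.single (spec_weight (h x)) (c x)) (spec_weight (h y)) =
        (if x = y then c x else 0)"
      by (simp add: lookup_single when_def)
  qed
  also have "\<dots> = c y" using \<open>finite A\<close> y by simp
  finally show ?thesis by simp
qed


section \<open>The valuation of a monomial\<close>

lemma chain_eval_add: "chain_eval C (p + q) = chain_eval C p + chain_eval C q"
  unfolding chain_eval_def poly_eval_def
  by (rule sum_keys_plus) (simp add: hibi_const_add distrib_right)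

lemma chain_eval_0: "chain_eval C 0 = 0"
  by (simp add: chain_eval_def poly_eval_def)

lemma chain_eval_diff: "chain_eval C (p - q) = chain_eval C p - chain_eval C q"
  using chain_eval_add[of C "p - q" q] by simp

lemma chain_eval_sum: "chain_eval C (sum f A) = (\<Sum>i\<in>A. chain_eval C (f i))"
  by (induction A rule: infinite_finite_induct) (simp_all add: chain_eval_0 chain_eval_add)

definition chain_exp ::
  "'a::{finite,distrib_lattice,bounded_lattice} set \<Rightarrow> (nat \<Rightarrow>\<^sub>0 nat) \<Rightarrow> ('a \<Rightarrow>\<^sub>0 nat)" where
  "chain_exp C e =
    (\<Sum>j = 1..lattice_rank TYPE('a). Poly_Mapping.single (chain_elem C j) (Poly_Mapping.lookup e j))"

definition exp_val ::
  "'a::{finite,distrib_lattice,bounded_lattice} set \<Rightarrow> (nat \<Rightarrow>\<^sub>0 nat) \<Rightarrow> 'a value_vec" where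
  "exp_val C e =
    (\<Sum>j = 1..lattice_rank TYPE('a). scale_vec (int (Poly_Mapping.lookup e j)) (chain_vec C j))"

lemma chain_exp_add: "chain_exp C (d + e) = chain_exp C d + chain_exp C e"
  by (simp add: chain_exp_def lookup_add single_add sum.distrib)

lemma exp_val_add: "exp_val C (d + e) = exp_val C d + exp_val C e"
proof -
  have "scale_vec (int (m + n)) v = scale_vec (int m) v + scale_vec (int n) v"
    for m n and v :: "'a value_vec"
    by transfer (auto simp: algebra_simps)
  then show ?thesis by (simp only: exp_val_def lookup_add sum.distrib)
qed

lemma poly_val_eq: "poly_val C p = Min (exp_val C ` Poly_Mapping.keys p)"
  by (simp add: poly_val_def exp_val_def)

lemma prod_keys_eq_xmon:
  fixes C :: "'a::{finite,distrib_lattice,bounded_lattice} set"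
  assumes "Poly_Mapping.keys e \<subseteq> {1..lattice_rank TYPE('a)}"
  shows "(\<Prod>j\<in>Poly_Mapping.keys e. xhat (chain_elem C j) ^ Poly_Mapping.lookup e j) = xmon (chain_exp C e)"
  unfolding chain_exp_def xmon_sum xmon_single
  by (intro prod.mono_neutral_left assms) (auto simp: in_keys_iff)

lemma chain_eval_eq:
  assumes "p \<in> chain_polys TYPE('a)"
  shows "chain_eval C p = (\<Sum>e\<in>Poly_Mapping.keys p.
    hibi_const (Poly_Mapping.lookup p e) *
    xmon (chain_exp (C :: 'a::{finite,distrib_lattice,bounded_lattice} set) e))"
  unfolding chain_eval_def poly_eval_def
  using assms by (intro sum.cong refl arg_cong2[of _ _ _ _ "(*)"] prod_keys_eq_xmon)
    (auto simp: chain_polys_def)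

lemma chain_eval_single:
  fixes C :: "'a::{finite,distrib_lattice,bounded_lattice} set"
  assumes "Poly_Mapping.keys e \<subseteq> {1..lattice_rank TYPE('a)}"
  shows "chain_eval C (Poly_Mapping.single e c) = hibi_const c * xmon (chain_exp C e)"
proof -
  \<comment> \<open>For \<open>c = 0\<close> the polynomial has no monomials, so this case is
    separate and needs the constant 0 to map to 0.\<close>
  have "hibi_const 0 = (0 :: 'a hibi_field)" using hibi_const_add[of 0 0] by (metis add_0 add_cancel_right_right)
  then show ?thesis
    using assms chain_eval_0[of C] by (cases "c = 0") (auto simp: chain_eval_eq chain_polys_def)
qed

lemma keys_plus_nat: "Poly_Mapping.keys (d + e) = Poly_Mapping.keys d \<union> Poly_Mapping.keys (e :: 'i \<Rightarrow>\<^sub>0 nat)"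
  by (auto simp: in_keys_iff lookup_add)

lemma chain_polys_mult_single:
  assumes "p \<in> chain_polys TYPE('a::{finite,distrib_lattice,bounded_lattice})"
    "Poly_Mapping.keys e \<subseteq> {1..lattice_rank TYPE('a)}"
  shows "p * Poly_Mapping.single e c \<in> chain_polys TYPE('a)"
  using assms keys_mult[of p "Poly_Mapping.single e c"]
  by (fastforce simp: chain_polys_def keys_plus_nat split: if_splits)

lemma chain_polys_diff:
  assumes "p \<in> chain_polys T" "q \<in> chain_polys T"
  shows "p - q \<in> chain_polys T"
  using assms keys_diff[of p q] unfolding chain_polys_def by blast

lemma chain_eval_mult_single:
  fixes C :: "'a::{finite,distrib_lattice,bounded_lattice} set"
  assumes p: "p \<in> chain_polys TYPE('a)" and e: "Poly_Mapping.keys e \<subseteq> {1..lattice_rank TYPE('a)}"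
  shows "chain_eval C (p * Poly_Mapping.single e 1) = chain_eval C p * xmon (chain_exp C e)"
proof -
  have "chain_eval C ((\<Sum>d\<in>Poly_Mapping.keys p. Poly_Mapping.single d (Poly_Mapping.lookup p d)) *
      Poly_Mapping.single e 1) = chain_eval C p * xmon (chain_exp C e)"
    unfolding sum_distrib_right chain_eval_sum chain_eval_eq[OF p] mult_single
  proof (intro sum.cong refl)
    fix d assume "d \<in> Poly_Mapping.keys p"
    then have "Poly_Mapping.keys (d + e) \<subseteq> {1..lattice_rank TYPE('a)}"
      using p e by (auto simp: chain_polys_def keys_plus_nat)
    then show "chain_eval C (Poly_Mapping.single (d + e) (Poly_Mapping.lookup p d * 1)) =
        hibi_const (Poly_Mapping.lookup p d) * xmon (chain_exp C d) * xmon (chain_exp C e)"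
      by (simp add: chain_eval_single chain_exp_add xmon_add)
  qed
  then show ?thesis by (simp only: poly_sum_single)
qed

text \<open>Shifting exponents by \<open>e\<close> is injective, so no terms merge or
  cancel.\<close>

lemma keys_mult_single:
  fixes p :: "('i \<Rightarrow>\<^sub>0 nat) \<Rightarrow>\<^sub>0 complex"
  shows "Poly_Mapping.keys (p * Poly_Mapping.single e 1) = (\<lambda>d. d + e) ` Poly_Mapping.keys p"
proof -
  have "Poly_Mapping.lookup (p * Poly_Mapping.single e 1) (d + e) = Poly_Mapping.lookup p d" for d
  proof -
    have "p * Poly_Mapping.single e 1 =
        (\<Sum>k\<in>Poly_Mapping.keys p. Poly_Mapping.single (k + e) (Poly_Mapping.lookup p k))"
      by (subst poly_sum_single[of p, symmetric]) (simp add: sum_distrib_right mult_single)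
    then have "Poly_Mapping.lookup (p * Poly_Mapping.single e 1) (d + e) =
        (\<Sum>k\<in>Poly_Mapping.keys p. if k = d then Poly_Mapping.lookup p k else 0)"
      by (simp only: lookup_sum lookup_single when_def add_right_cancel)
    then show ?thesis by (simp add: in_keys_iff)
  qed
  then show ?thesis using keys_mult[of p "Poly_Mapping.single e 1"]
    by (auto simp: in_keys_iff)
qed

text \<open>All values are translated by \<open>exp_val C e\<close>, and a translation is monotone,
  hence commutes with the minimum.\<close>

lemma poly_val_mult_single:
  assumes "p \<noteq> 0"
  shows "poly_val C (p * Poly_Mapping.single e 1) = poly_val C p + exp_val C e"
proof -
  have "(\<lambda>d. exp_val C (d + e)) ` Poly_Mapping.keys p = (\<lambda>v. v + exp_val C e) ` exp_val C ` Poly_Mapping.keys p"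
    by (simp add: image_image exp_val_add)
  moreover have "Min ((\<lambda>v. v + exp_val C e) ` exp_val C ` Poly_Mapping.keys p) = poly_val C p + exp_val C e"
    unfolding poly_val_eq using assms
    by (intro mono_Min_commute[symmetric]) (auto simp: mono_def add_right_mono)
  ultimately show ?thesis by (simp add: poly_val_eq keys_mult_single image_image)
qed

lemma coord_sum: "coord (sum f A) i = (\<Sum>x\<in>A. coord (f x) i)"
  by (induction A rule: infinite_finite_induct) (simp_all add: zero_value_vec.rep_eq plus_value_vec.rep_eq)

lemma coord_outside:
  "i \<notin> {1..lattice_rank TYPE('a)} \<Longrightarrow> coord (v :: 'a::{finite,distrib_lattice,bounded_lattice} value_vec) i = 0"
  using coord[of v] by blast

section \<open>Algebraic independence and the valuation of a fixed chain\<close>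

context
  fixes C :: "'a::{finite,distrib_lattice,bounded_lattice} set"
  assumes C: "C \<in> max_chains"
begin

lemma spec_count_chain_exp:
  assumes "i \<in> {1..lattice_rank TYPE('a)}"
  shows "spec_count (chain_exp C e) (chain_irr C i) =
    (\<Sum>j = i..lattice_rank TYPE('a). Poly_Mapping.lookup e j)"
proof -
  have "spec_count (chain_exp C e) (chain_irr C i) =
      (\<Sum>j = 1..lattice_rank TYPE('a). if i \<le> j then Poly_Mapping.lookup e j else 0)"
    unfolding chain_exp_def spec_count_sum spec_count_single
    using assms by (intro sum.cong) (auto simp: chain_irr_le_chain_elem_iff[OF C])
  also have "\<dots> = (\<Sum>j\<in>{j \<in> {1..lattice_rank TYPE('a)}. i \<le> j}. Poly_Mapping.lookup e j)"
    by (rule sum.inter_filter[symmetric]) simp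
  also have "{j \<in> {1..lattice_rank TYPE('a)}. i \<le> j} = {i..lattice_rank TYPE('a)}"
    using assms by auto
  finally show ?thesis .
qed

text \<open>Both sides are the tail sum of the exponents from \<open>i\<close> on, since
  \<open>chain_irr C i\<close> lies below \<open>chain_elem C j\<close> exactly for
  \<open>i \<le> j\<close>.\<close>

lemma coord_exp_val:
  assumes "i \<in> {1..lattice_rank TYPE('a)}"
  shows "coord (exp_val C e) i = int (spec_count (chain_exp C e) (chain_irr C i))"
proof -
  have "coord (chain_vec C j) i = of_bool (i \<le> j)" if "j \<in> {1..lattice_rank TYPE('a)}" for j
  proof -
    have "chain_irr C i \<in> Spec_star (chain_elem C j) \<longleftrightarrow> i \<le> j"
      using that assms chain_irr_le_chain_elem_iff[OF C] chain_irr_irreducible[OF C assms]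
      by (auto simp: Spec_star_def Spec_def)
    moreover have "coord (chain_vec C j) i = (\<Sum>i'\<in>{i' \<in> {1..lattice_rank TYPE('a)}.
        chain_irr C i' \<in> Spec_star (chain_elem C j)}. if i' = i then 1 else 0)"
      unfolding chain_vec_def coord_sum by (intro sum.cong) (auto simp: unit_vec.rep_eq)
    ultimately show ?thesis using assms by simp
  qed
  then have "coord (exp_val C e) i =
      (\<Sum>j = 1..lattice_rank TYPE('a). if i \<le> j then int (Poly_Mapping.lookup e j) else 0)"
    unfolding exp_val_def coord_sum scale_vec.rep_eq by (intro sum.cong) auto
  also have "\<dots> = (\<Sum>j\<in>{j \<in> {1..lattice_rank TYPE('a)}. i \<le> j}. int (Poly_Mapping.lookup e j))"
    by (rule sum.inter_filter[symmetric]) simp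
  also have "{j \<in> {1..lattice_rank TYPE('a)}. i \<le> j} = {i..lattice_rank TYPE('a)}"
    using assms by auto
  finally show ?thesis by (simp add: spec_count_chain_exp[OF assms])
qed

text \<open>The counts are tail sums of the exponents, and consecutive tail sums differ by a single
  exponent.\<close>

lemma chain_exp_inj:
  assumes d: "Poly_Mapping.keys d \<subseteq> {1..lattice_rank TYPE('a)}"
    and e: "Poly_Mapping.keys e \<subseteq> {1..lattice_rank TYPE('a)}"
    and eq: "\<And>m. join_irreducible m \<Longrightarrow> m \<noteq> bot \<Longrightarrow>
      spec_count (chain_exp C d) m = spec_count (chain_exp C e) m"
  shows "d = e"
proof (rule poly_mapping_eqI)
  let ?N = "lattice_rank TYPE('a)"
  fix i
  show "Poly_Mapping.lookup d i = Poly_Mapping.lookup e i"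
  proof (cases "i \<in> {1..?N}")
    case True
    \<comment> \<open>Indices beyond the rank are included, with empty sums, because the last
      exponent is recovered from the tails at \<open>?N\<close> and \<open>Suc ?N\<close>.\<close>
    have tails: "(\<Sum>j = i..?N. Poly_Mapping.lookup d j) = (\<Sum>j = i..?N. Poly_Mapping.lookup e j)"
      if "1 \<le> i" for i
    proof (cases "i \<le> ?N")
      case True
      then have i: "i \<in> {1..?N}" using that by simp
      show ?thesis
        unfolding spec_count_chain_exp[OF i, symmetric]
        by (intro eq chain_irr_irreducible[OF C i])
    qed simp
    show ?thesis using tails[of i] tails[of "Suc i"] True by (simp add: sum.atLeast_Suc_atMost[of i ?N])
  next
    case False
    then show ?thesis using d e by (metis in_keys_iff subsetD)
  qed
qed

text \<open>Algebraic independence of the coordinates along \<open>C\<close>: by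
  \<open>chain_exp_inj\<close>, distinct monomials in them satisfy the hypothesis of
  \<open>xmon_independent\<close>.\<close>

lemma chain_eval_eq_0:
  assumes p: "p \<in> chain_polys TYPE('a)" and 0: "chain_eval C p = 0"
  shows "p = 0"
proof -
  have "Poly_Mapping.lookup p e = 0" if "e \<in> Poly_Mapping.keys p" for e
  proof (rule xmon_independent[OF _ _ 0[unfolded chain_eval_eq[OF p]] that])
    show "x = y" if "x \<in> Poly_Mapping.keys p" "y \<in> Poly_Mapping.keys p"
      "\<And>m. join_irreducible m \<Longrightarrow> m \<noteq> bot \<Longrightarrow>
        spec_count (chain_exp C x) m = spec_count (chain_exp C y) m" for x y
      using that p by (intro chain_exp_inj[OF _ _ that(3)]) (auto simp: chain_polys_def)
  qed simp
  then show ?thesis by (metis in_keys_iff poly_mapping_eqI lookup_zero)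
qed

text \<open>Shows that the definite description in \<open>chain_val\<close> is well defined at
  quotients of chain monomials. Cross-multiplying with any other representation gives an identity of
  polynomials, by algebraic independence, in which each side is a polynomial times a
  monomial.\<close>

lemma chain_val_eq:
  assumes d: "Poly_Mapping.keys d \<subseteq> {1..lattice_rank TYPE('a)}"
    and e: "Poly_Mapping.keys e \<subseteq> {1..lattice_rank TYPE('a)}"
    and h: "h * xmon (chain_exp C e) = xmon (chain_exp C d)"
  shows "chain_val C h = exp_val C d - exp_val C e"
  unfolding chain_val_def
proof (rule the_equality)
  let ?d = "Poly_Mapping.single d (1::complex)" and ?e = "Poly_Mapping.single e (1::complex)"
  have de: "?d \<in> chain_polys TYPE('a)" "?e \<in> chain_polys TYPE('a)"
    using d e by (simp_all add: chain_polys_def)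
  have nz: "?d \<noteq> 0" "?e \<noteq> 0" by (simp_all flip: keys_eq_empty)
  have "chain_eval C ?e \<noteq> 0" using chain_eval_eq_0 de nz by blast
  then have "h = chain_eval C ?d / chain_eval C ?e"
    using h by (simp add: chain_eval_single[OF d] chain_eval_single[OF e] hibi_const_1 nonzero_eq_divide_eq)
  moreover have "exp_val C d - exp_val C e = poly_val C ?d - poly_val C ?e"
    by (simp add: poly_val_eq)
  ultimately show "\<exists>p q. p \<in> chain_polys TYPE('a) \<and> q \<in> chain_polys TYPE('a) \<and> p \<noteq> 0 \<and> q \<noteq> 0 \<and>
      h = chain_eval C p / chain_eval C q \<and> exp_val C d - exp_val C e = poly_val C p - poly_val C q"
    using de nz by blast
  fix u
  assume "\<exists>p q. p \<in> chain_polys TYPE('a) \<and> q \<in> chain_polys TYPE('a) \<and> p \<noteq> 0 \<and> q \<noteq> 0 \<and>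
      h = chain_eval C p / chain_eval C q \<and> u = poly_val C p - poly_val C q"
  then obtain p q where pq: "p \<in> chain_polys TYPE('a)" "q \<in> chain_polys TYPE('a)" "p \<noteq> 0" "q \<noteq> 0"
    "h = chain_eval C p / chain_eval C q" "u = poly_val C p - poly_val C q" by blast
  have "chain_eval C q \<noteq> 0" using chain_eval_eq_0 pq by blast
  then have "chain_eval C p * xmon (chain_exp C e) = chain_eval C q * xmon (chain_exp C d)"
    using h pq(5) by (simp add: field_simps)
  then have "chain_eval C (p * ?e - q * ?d) = 0"
    by (simp add: chain_eval_diff chain_eval_mult_single[OF pq(1) e] chain_eval_mult_single[OF pq(2) d])
  then have "p * ?e - q * ?d = 0"
    by (intro chain_eval_eq_0 chain_polys_diff chain_polys_mult_single pq d e)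
  then have "poly_val C p + exp_val C e = poly_val C q + exp_val C d"
    using poly_val_mult_single[OF pq(3)] poly_val_mult_single[OF pq(4)] by (metis eq_iff_diff_eq_0)
  then show "u = exp_val C d - exp_val C e"
    unfolding pq(6) by (simp add: algebra_simps)
qed

text \<open>
  With \<open>F\<^sub>i\<close> the \<open>i\<close>-th coordinate and \<open>F\<close> extended by \<open>0\<close> beyond the rank, the monomial is the
  quotient of the monomials in the chain with exponents \<open>F\<^sub>j\<close> and \<open>F\<^bsub>j+1\<^esub>\<close>.
\<close>

lemma coord_chain_val_xmon:
  assumes i: "i \<in> {1..lattice_rank TYPE('a)}"
  shows "coord (chain_val C (xmon a)) i = int (spec_count a (chain_irr C i))"
proof -
  let ?N = "lattice_rank TYPE('a)"
  define F where "F i = (if i \<le> ?N then spec_count a (chain_irr C i) else 0)" for i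
  define d where "d = (\<Sum>j = 1..?N. Poly_Mapping.single j (F j))"
  define e where "e = (\<Sum>j = 1..?N. Poly_Mapping.single j (F (Suc j)))"
  have lookup: "Poly_Mapping.lookup (\<Sum>j = 1..?N. Poly_Mapping.single j (f j)) i =
      (if i \<in> {1..?N} then f i else 0)" for f :: "nat \<Rightarrow> nat" and i
    by (simp add: lookup_sum lookup_single when_def)
  have keys: "Poly_Mapping.keys d \<subseteq> {1..?N}" "Poly_Mapping.keys e \<subseteq> {1..?N}"
    unfolding d_def e_def by (auto simp only: in_keys_iff lookup split: if_splits)
  \<comment> \<open>Telescoping: the tail sums of \<open>F\<close> and of its shift differ by
    \<open>F i\<close>.\<close>
  have count: "spec_count (a + chain_exp C e) (chain_irr C i) = spec_count (chain_exp C d) (chain_irr C i)"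
    if i: "i \<in> {1..?N}" for i
  proof -
    have "spec_count (chain_exp C d) (chain_irr C i) = (\<Sum>j = i..?N. F j)"
      unfolding spec_count_chain_exp[OF i] d_def lookup using i by (intro sum.cong) auto
    \<comment> \<open>The added term is 0 by the choice of \<open>F\<close> beyond the rank.\<close>
    also have "\<dots> = (\<Sum>j = i..Suc ?N. F j)"
      using i by (simp add: F_def)
    also have "\<dots> = F i + (\<Sum>j = Suc i..Suc ?N. F j)"
      using i by (intro sum.atLeast_Suc_atMost) simp
    also have "(\<Sum>j = Suc i..Suc ?N. F j) = spec_count (chain_exp C e) (chain_irr C i)"
      unfolding spec_count_chain_exp[OF i] e_def lookup sum.shift_bounds_cl_Suc_ivl
      using i by (intro sum.cong) auto
    finally show ?thesis using i by (simp add: spec_count_add F_def)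
  qed
  have "xmon (a + chain_exp C e) = xmon (chain_exp C d)"
  proof (rule xmon_eqI)
    fix m :: 'a assume "join_irreducible m" "m \<noteq> bot"
    then have "m \<in> Spec_star top" by (simp add: Spec_star_def Spec_def)
    then obtain i where "i \<in> {1..?N}" "m = chain_irr C i"
      using bij_betw_imp_surj_on[OF chain_irr_bij_betw[OF C]] by blast
    then show "spec_count (a + chain_exp C e) m = spec_count (chain_exp C d) m"
      using count by simp
  qed
  then have "chain_val C (xmon a) = exp_val C d - exp_val C e"
    using keys by (intro chain_val_eq) (simp_all add: xmon_add)
  then show ?thesis
    using count[OF i] by (simp add: minus_value_vec.rep_eq coord_exp_val[OF i] spec_count_add)
qed

end


section \<open>The quasi-valuation of a monomial\<close>

lemma scale_vec_strict_mono:
  assumes "u < v" "n \<noteq> 0"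
  shows "scale_vec (int n) u < scale_vec (int n) v"
  using assms by (auto simp: less_value_vec_def minus_value_vec.rep_eq scale_vec.rep_eq)

lemma scale_vec_mono:
  assumes "u \<le> v"
  shows "scale_vec (int n) u \<le> scale_vec (int n) v"
proof -
  have "scale_vec 0 w = 0" for w :: "'a value_vec" by transfer simp
  then show ?thesis
    using assms scale_vec_strict_mono[of u v n] by (cases "n = 0") (auto simp: order_le_less)
qed

lemma value_vec_eqI:
  fixes u v :: "'a::{finite,distrib_lattice,bounded_lattice} value_vec"
  assumes "\<And>i. i \<in> {1..lattice_rank TYPE('a)} \<Longrightarrow> coord u i = coord v i"
  shows "u = v"
proof -
  have "coord u = coord v" using assms coord_outside by (metis ext)
  then show ?thesis by (simp add: coord_inject)
qed

text \<open>At the last coordinate \<open>i\<close> where the vectors differ, \<open>u\<close> must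
  have the one: otherwise \<open>A\<close> would be contained in \<open>{1..card A} - {i}\<close>,
  which has too few elements.\<close>

lemma initial_segment_less:
  assumes "finite A" "0 \<notin> A" "A \<noteq> {1..card A}"
    and u: "\<And>i. coord u i = of_bool (i \<in> A)"
    and v: "\<And>i. coord v i = of_bool (i \<in> {1..card A})"
  shows "v < u"
proof -
  have "u \<noteq> v"
  proof
    assume "u = v"
    then have "i \<in> A \<longleftrightarrow> i \<in> {1..card A}" for i
      using u[of i] v[of i] by (simp only: of_bool_eq_iff)
    with assms(3) show False by blast
  qed
  then obtain i where i: "coord u i \<noteq> coord v i" "\<forall>j>i. coord u j = coord v j"
    by (rule last_coord_diff)
  have above: "j \<in> A \<longleftrightarrow> j \<in> {1..card A}" if "j > i" for j
    using i(2) that u[of j] v[of j] by (simp only: of_bool_eq_iff)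
  have "i \<in> A"
  proof (rule ccontr)
    assume "i \<notin> A"
    then have i_in: "i \<in> {1..card A}" using i(1) u[of i] v[of i] by (metis of_bool_eq(1))
    have "x \<in> {1..card A} - {i}" if "x \<in> A" for x
    proof (cases "x < i")
      case True
      moreover have "x \<noteq> 0" using that \<open>0 \<notin> A\<close> by metis
      ultimately show ?thesis using i_in by simp
    next
      case False
      moreover have "x \<noteq> i" using that \<open>i \<notin> A\<close> by metis
      ultimately show ?thesis using above[of x] that by simp
    qed
    then have "A \<subseteq> {1..card A} - {i}" by blast
    then have "card A \<le> card ({1..card A} - {i})" by (intro card_mono) auto
    with i_in show False by auto
  qed
  moreover have "i \<notin> {1..card A}" using i(1) u[of i] v[of i] \<open>i \<in> A\<close> by (metis of_bool_eq(2))
  ultimately have "coord (u - v) i > 0" using u[of i] v[of i] by (simp add: minus_value_vec.rep_eq)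
  with i(2) show ?thesis
    unfolding less_value_vec_def by (auto simp: minus_value_vec.rep_eq)
qed

text \<open>The support of the 0/1-vector \<open>chain_val C (xhat l)\<close>, by
  \<open>coord_chain_val_xhat\<close>.\<close>

definition irr_indices :: "'a::{finite,distrib_lattice,bounded_lattice} set \<Rightarrow> 'a \<Rightarrow> nat set" where
  "irr_indices C l = {i \<in> {1..lattice_rank TYPE('a)}. chain_irr C i \<le> l}"

context
  fixes C :: "'a::{finite,distrib_lattice,bounded_lattice} set"
  assumes C: "C \<in> max_chains"
begin

lemma coord_chain_val_xhat: "coord (chain_val C (xhat l)) i = of_bool (i \<in> irr_indices C l)"
proof (cases "i \<in> {1..lattice_rank TYPE('a)}")
  case True
  then show ?thesis
    using coord_chain_val_xmon[OF C True, of "Poly_Mapping.single l 1"]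
    unfolding xmon_single by (simp add: spec_count_single irr_indices_def)
next
  case False
  then show ?thesis using coord_outside[OF False] by (auto simp: irr_indices_def)
qed

text \<open>In each coordinate both sides count the indices \<open>l j\<close> above
  \<open>chain_irr C i\<close>, with multiplicity \<open>n j\<close>.\<close>

lemma chain_val_xhat_monomial:
  "chain_val C (xhat_monomial k l n) = (\<Sum>j = 1..k. scale_vec (int (n j)) (chain_val C (xhat (l j))))"
proof (rule value_vec_eqI)
  fix i assume i: "i \<in> {1..lattice_rank TYPE('a)}"
  have "xhat_monomial k l n = xmon (\<Sum>j = 1..k. Poly_Mapping.single (l j) (n j))"
    by (simp add: xhat_monomial_def xmon_sum xmon_single)
  then show "coord (chain_val C (xhat_monomial k l n)) i =
      coord (\<Sum>j = 1..k. scale_vec (int (n j)) (chain_val C (xhat (l j)))) i"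
    using i by (simp add: coord_chain_val_xmon[OF C i] spec_count_sum spec_count_single coord_sum
        scale_vec.rep_eq coord_chain_val_xhat irr_indices_def)
qed

lemma chain_irr_image_irr_indices: "chain_irr C ` irr_indices C l = Spec_star l"
proof -
  have "chain_irr C ` irr_indices C l = {m \<in> chain_irr C ` {1..lattice_rank TYPE('a)}. m \<le> l}"
    by (auto simp: irr_indices_def)
  also have "\<dots> = {m \<in> Spec_star top. m \<le> l}"
    by (simp only: bij_betw_imp_surj_on[OF chain_irr_bij_betw[OF C]])
  also have "\<dots> = Spec_star l" by (auto simp: Spec_star_def Spec_def)
  finally show ?thesis .
qed

text \<open>The number of ones does not depend on \<open>C\<close>; this is what lets
  \<open>initial_segment_less\<close> compare two chains.\<close>

lemma card_irr_indices: "card (irr_indices C l) = rk l"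
proof -
  have "inj_on (chain_irr C) (irr_indices C l)"
    using bij_betw_imp_inj_on[OF chain_irr_bij_betw[OF C]] by (rule inj_on_subset) (auto simp: irr_indices_def)
  from card_image[OF this] show ?thesis by (simp add: chain_irr_image_irr_indices rk_def)
qed

text \<open>For \<open>c\<close> in \<open>C\<close> the index set is initial by the threshold
  property of \<open>chain_irr\<close>. Conversely, an initial segment of length \<open>rk l\<close>
  also belongs to the element of \<open>C\<close> of that rank, so both elements have the same
  spectrum and coincide.\<close>

lemma irr_indices_initial_iff: "irr_indices C l = {1..rk l} \<longleftrightarrow> l \<in> C"
proof -
  have initial: "irr_indices C c = {1..rk c}" if "c \<in> C" for c
  proof -
    have "chain_irr C i \<le> c \<longleftrightarrow> i \<le> rk c" if "i \<in> {1..lattice_rank TYPE('a)}" for i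
      using chain_irr_le_chain_elem_iff[OF C that rk_le[of c]] chain_elem_rk[OF C \<open>c \<in> C\<close>] by simp
    then show ?thesis using rk_le[of c] by (auto simp: irr_indices_def)
  qed
  moreover have "l \<in> C" if eq: "irr_indices C l = {1..rk l}"
  proof -
    let ?c = "chain_elem C (rk l)"
    have c: "?c \<in> C" "rk ?c = rk l" using chain_elem[OF C rk_le] by auto
    then have "Spec_star l = Spec_star ?c"
      using initial[OF c(1)] eq chain_irr_image_irr_indices by metis
    then have "Spec l = Spec ?c"
      using bot_in_Spec[of l] bot_in_Spec[of ?c] unfolding Spec_star_def by blast
    then show ?thesis using c(1) by (simp add: Spec_eq_iff)
  qed
  ultimately show ?thesis by blast
qed

end

lemma chain_val_xhat_less:
  assumes "C \<in> max_chains" "D \<in> max_chains" "l \<in> D" "l \<notin> C"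
  shows "chain_val D (xhat l) < chain_val C (xhat l)"
proof (rule initial_segment_less)
  show "finite (irr_indices C l)" "0 \<notin> irr_indices C l" by (simp_all add: irr_indices_def)
  show "irr_indices C l \<noteq> {1..card (irr_indices C l)}"
    using assms by (simp only: card_irr_indices irr_indices_initial_iff not_False_eq_True)
  show "coord (chain_val C (xhat l)) i = of_bool (i \<in> irr_indices C l)" for i
    using assms by (simp add: coord_chain_val_xhat)
  have "irr_indices D l = {1..rk l}" using assms by (simp only: irr_indices_initial_iff)
  then show "coord (chain_val D (xhat l)) i = of_bool (i \<in> {1..card (irr_indices C l)})" for i
    using assms by (simp only: coord_chain_val_xhat card_irr_indices)
qed

lemma chain_val_xhat_eq:
  assumes "C \<in> max_chains" "D \<in> max_chains" "l \<in> D" "l \<in> C"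
  shows "chain_val D (xhat l) = chain_val C (xhat l)"
proof -
  have "irr_indices D l = irr_indices C l"
    using assms irr_indices_initial_iff by metis
  then show ?thesis using assms by (intro value_vec_eqI) (simp add: coord_chain_val_xhat)
qed

section \<open>The minimum over all maximal chains\<close>

lemma spec_val_le: "C \<in> max_chains \<Longrightarrow> spec_val h \<le> chain_val C h"
  unfolding spec_val_def by (intro Min_le) auto

lemma spec_val_attained:
  obtains C where "C \<in> max_chains" "spec_val h = chain_val C h"
proof -
  have "spec_val h \<in> (\<lambda>C. chain_val C h) ` max_chains"
    unfolding spec_val_def using max_chains_nonempty by (intro Min_in) auto
  with that show ?thesis by blast
qed

text \<open>Some maximal chain contains \<open>l\<close>. Chains missing \<open>l\<close> give a
  strictly larger value than it does, and all chains through \<open>l\<close> give the same value,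
  so the minimum is attained exactly at the latter.\<close>

lemma spec_val_xhat_eq_iff:
  assumes "C \<in> max_chains"
  shows "spec_val (xhat l) = chain_val C (xhat l) \<longleftrightarrow> l \<in> C"
proof -
  obtain D where D: "D \<in> max_chains" "l \<in> D"
    using chain_extends_to_max_chain[of "{l}"] by auto
  obtain E where E: "E \<in> max_chains" "spec_val (xhat l) = chain_val E (xhat l)"
    by (rule spec_val_attained)
  have "l \<in> E"
    using chain_val_xhat_less[OF E(1) D] spec_val_le[OF D(1), of "xhat l"] E(2) by force
  then show ?thesis
    using chain_val_xhat_less[OF assms E(1)] chain_val_xhat_eq[OF assms E(1)] E(2) by force
qed

text \<open>Turns the sorting permutation into pairwise comparability, the form needed for extending
  to a maximal chain. A permutation is recovered by sorting a linear extension of the order.\<close>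

lemma standard_indices_iff:
  fixes l :: "nat \<Rightarrow> 'a::{finite,order}"
  shows "standard_indices k l \<longleftrightarrow> (\<forall>x\<in>l ` {1..k}. \<forall>y\<in>l ` {1..k}. x \<le> y \<or> y \<le> x)"
proof
  assume "standard_indices k l"
  then obtain \<pi> where \<pi>: "\<pi> permutes {1..k}"
    "\<forall>i\<in>{1..k}. \<forall>j\<in>{1..k}. i \<le> j \<longrightarrow> l (\<pi> j) \<le> l (\<pi> i)"
    unfolding standard_indices_def by blast
  show "\<forall>x\<in>l ` {1..k}. \<forall>y\<in>l ` {1..k}. x \<le> y \<or> y \<le> x"
  proof (intro ballI)
    fix x y assume "x \<in> l ` {1..k}" "y \<in> l ` {1..k}"
    then have "x \<in> l ` \<pi> ` {1..k}" "y \<in> l ` \<pi> ` {1..k}"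
      by (simp_all only: permutes_image[OF \<pi>(1)])
    then obtain i j where "i \<in> {1..k}" "x = l (\<pi> i)" "j \<in> {1..k}" "y = l (\<pi> j)" by blast
    then show "x \<le> y \<or> y \<le> x" using \<pi>(2) nat_le_linear[of i j] by blast
  qed
next
  \<comment> \<open>The size of the down-set is strictly monotone; the sign in \<open>key\<close>
    makes the ascending sort list larger elements first.\<close>
  assume comparable: "\<forall>x\<in>l ` {1..k}. \<forall>y\<in>l ` {1..k}. x \<le> y \<or> y \<le> x"
  define key where "key j = - int (card {..l j})" for j
  define xs where "xs = sort_key key [1..<Suc k]"
  \<comment> \<open>List positions start at 0 and indices at 1. Outside \<open>{1..k}\<close> the
    map is the identity, as \<open>permutes\<close> demands.\<close>
  define \<pi> where "\<pi> i = (if i \<in> {1..k} then xs ! (i - 1) else i)" for i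
  have xs: "length xs = k" "set xs = {1..k}" "distinct xs" "sorted (map key xs)"
    by (auto simp: xs_def)
  have "bij_betw \<pi> {1..k} {1..k}"
  proof -
    have "bij_betw (\<lambda>i. i - 1) {1..k} {..<k}"
      by (rule bij_betw_byWitness[where f' = Suc]) auto
    moreover have "bij_betw ((!) xs) {..<k} {1..k}"
      using bij_betw_nth[OF xs(3)] xs by metis
    ultimately have "bij_betw ((!) xs \<circ> (\<lambda>i. i - 1)) {1..k} {1..k}" by (rule bij_betw_trans)
    then show ?thesis by (rule bij_betw_cong[THEN iffD1, rotated]) (simp add: \<pi>_def)
  qed
  then have "\<pi> permutes {1..k}" by (rule bij_imp_permutes) (auto simp: \<pi>_def)
  moreover have "l (\<pi> j) \<le> l (\<pi> i)" if ij: "i \<in> {1..k}" "j \<in> {1..k}" "i \<le> j" for i j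
  proof (rule ccontr)
    assume "\<not> l (\<pi> j) \<le> l (\<pi> i)"
    moreover have "l (\<pi> i) \<in> l ` {1..k}" "l (\<pi> j) \<in> l ` {1..k}"
      using ij permutes_in_image[OF \<open>\<pi> permutes {1..k}\<close>] by blast+
    ultimately have "l (\<pi> i) < l (\<pi> j)" using comparable by (meson less_le_not_le)
    then have "{..l (\<pi> i)} \<subset> {..l (\<pi> j)}" by (auto simp: less_le psubset_eq)
    then have "card {..l (\<pi> i)} < card {..l (\<pi> j)}" by (intro psubset_card_mono) auto
    moreover have "key (\<pi> i) \<le> key (\<pi> j)"
      using sorted_nth_mono[OF xs(4), of "i - 1" "j - 1"] ij xs(1) by (auto simp: \<pi>_def)
    ultimately show False by (simp add: key_def)
  qed
  ultimately show "standard_indices k l" unfolding standard_indices_def by blast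
qed

text \<open>In the equality case of the first claim, standardness excludes monomials whose indices
  lie in no maximal chain: their minimum is still attained at some chain, which then cannot contain
  all indices.\<close>

theorem theorem5p1:
  fixes k :: nat
    and l :: "nat \<Rightarrow> 'a::{finite,distrib_lattice,bounded_lattice}"
    and n :: "nat \<Rightarrow> nat"
  assumes n_nonzero: "\<And>j. j \<in> {1..k} \<Longrightarrow> n j \<noteq> 0"
  shows
    "(\<forall>C\<in>max_chains.
        spec_val (xhat_monomial k l n) \<le> chain_val C (xhat_monomial k l n) \<and>
        (standard_indices k l \<and>
          spec_val (xhat_monomial k l n) = chain_val C (xhat_monomial k l n)
          \<longrightarrow> l ` {1..k} \<subseteq> C)) \<and>
     (standard_indices k l \<longrightarrow>
        (\<forall>C\<in>max_chains. l ` {1..k} \<subseteq> C \<longrightarrow>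
          spec_val (xhat_monomial k l n) = (\<Sum>j = 1..k. scale_vec (int (n j)) (spec_val (xhat (l j)))) \<and>
          (\<Sum>j = 1..k. scale_vec (int (n j)) (spec_val (xhat (l j)))) =
            (\<Sum>j = 1..k. scale_vec (int (n j)) (chain_val C (xhat (l j)))))) \<and>
     (\<not> standard_indices k l \<longrightarrow>
        spec_val (xhat_monomial k l n) > (\<Sum>j = 1..k. scale_vec (int (n j)) (spec_val (xhat (l j)))))"
proof -
  let ?S = "\<Sum>j = 1..k. scale_vec (int (n j)) (spec_val (xhat (l j)))"
  let ?M = "xhat_monomial k l n"
  have ge: "?S \<le> chain_val C ?M" if "C \<in> max_chains" for C
    unfolding chain_val_xhat_monomial[OF that]
    by (intro sum_mono scale_vec_mono spec_val_le that)
  \<comment> \<open>One index outside \<open>C\<close> makes its summand strictly larger, since its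
    exponent is nonzero, and the other summands are at least as large.\<close>
  have greater: "?S < chain_val C ?M" if C: "C \<in> max_chains" and notin: "\<not> l ` {1..k} \<subseteq> C" for C
  proof -
    obtain j where j: "j \<in> {1..k}" "l j \<notin> C" using notin by blast
    have "spec_val (xhat (l j)) < chain_val C (xhat (l j))"
      using spec_val_le[OF C, of "xhat (l j)"] spec_val_xhat_eq_iff[OF C, of "l j"] j(2) by simp
    then have "scale_vec (int (n j)) (spec_val (xhat (l j))) <
        scale_vec (int (n j)) (chain_val C (xhat (l j)))"
      using n_nonzero[OF j(1)] by (rule scale_vec_strict_mono)
    then show ?thesis
      unfolding chain_val_xhat_monomial[OF C] using j(1)
      by (intro sum_strict_mono_ex1) (auto intro!: scale_vec_mono spec_val_le C)
  qed
  have eq: "?S = (\<Sum>j = 1..k. scale_vec (int (n j)) (chain_val C (xhat (l j))))"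
    if "C \<in> max_chains" "l ` {1..k} \<subseteq> C" for C
  proof (intro sum.cong refl)
    fix j assume "j \<in> {1..k}"
    then have "l j \<in> C" using that(2) by blast
    then show "scale_vec (int (n j)) (spec_val (xhat (l j))) =
        scale_vec (int (n j)) (chain_val C (xhat (l j)))"
      using spec_val_xhat_eq_iff[OF that(1), of "l j"] by simp
  qed
  \<comment> \<open>The lower bound \<open>?S\<close> holds for every chain, in particular a
    minimizing one, and is attained at \<open>C\<close>.\<close>
  have spec_eq: "spec_val ?M = ?S" if C: "C \<in> max_chains" "l ` {1..k} \<subseteq> C" for C
  proof (rule antisym)
    show "spec_val ?M \<le> ?S"
      using spec_val_le[OF C(1), of ?M] unfolding eq[OF C] chain_val_xhat_monomial[OF C(1)] .
    obtain D where "D \<in> max_chains" "spec_val ?M = chain_val D ?M" by (rule spec_val_attained)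
    then show "?S \<le> spec_val ?M" using ge by simp
  qed
  have standard: "\<exists>C\<in>max_chains. l ` {1..k} \<subseteq> C" if "standard_indices k l"
    using that chain_extends_to_max_chain[of "l ` {1..k}"] unfolding standard_indices_iff by metis
  show ?thesis
  proof (intro conjI impI ballI)
    fix C :: "'a set" assume C: "C \<in> max_chains"
    show "spec_val ?M \<le> chain_val C ?M" by (rule spec_val_le[OF C])
    \<comment> \<open>Standardness provides some chain containing all indices, so the minimum equals
      \<open>?S\<close>; a chain missing an index has a value strictly above
      \<open>?S\<close>.\<close>
    assume "standard_indices k l \<and> spec_val ?M = chain_val C ?M"
    then show "l ` {1..k} \<subseteq> C"
      using standard spec_eq greater[OF C] by (metis less_irrefl)
  next
    fix C :: "'a set" assume "C \<in> max_chains" "l ` {1..k} \<subseteq> C"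
    then show "spec_val ?M = ?S"
      "?S = (\<Sum>j = 1..k. scale_vec (int (n j)) (chain_val C (xhat (l j))))"
      using spec_eq eq by blast+
  next
    assume not_standard: "\<not> standard_indices k l"
    \<comment> \<open>A minimizing chain cannot contain all indices, since these are not pairwise
      comparable; the strict bound at \<open>D\<close> is thus a strict bound for the
      minimum.\<close>
    obtain D where D: "D \<in> max_chains" "spec_val ?M = chain_val D ?M" by (rule spec_val_attained)
    have "\<not> l ` {1..k} \<subseteq> D"
      using not_standard max_chains_comparable[OF D(1)] unfolding standard_indices_iff by blast
    then show "?S < spec_val ?M" using greater[OF D(1)] D(2) by simp
  qed
qed

end
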